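(* Let $p$ and $q$ be monic real-rooted polynomials of degree $n$, each with simple roots, having a common interlacer. Let $\lambda_1>\dots>\lambda_n$ be the roots of $p$ and $\mu_1>\dots>\mu_n$ the roots of $q$. Then $p$ strongly majorizes $q$ (written $p\succeq^s q$) if and only if $$\sum_{i=1}^{k} \frac{q(\lambda_i)}{p'(\lambda_i)} \ge 0 \ \text{ for all integers } 1\le k<n \qquad\text{and}\qquad \sum_{i=1}^n\lambda_i=\sum_{i=1}^n\mu_i .$$
   Context: Roots are always listed in nonincreasing order (with multiplicity). Majorization: for real vectors $a_1\ge\dots\ge a_n$ and $b_1\ge\dots\ge b_n$, $a\succeq b$ means $\sum_{i=1}^k a_i\ge\sum_{i=1}^k b_i$ for all $k\le n$ and $\sum_{i=1}^n a_i=\sum_{i=1}^n b_i$. For real-rooted polynomials of the same degree, one majorizes the other ($\succeq$) if its ordered root vector majorizes that of the other. Common interlacer: $p$ and $q$ have a common interlacer if there is a third polynomial interlacing both; explicitly, the closed intervals with endpoints $\lambda_i,\mu_i$ ($1\le i\le n$) are non-crossing, i.e. $\max(\lambda_{i+1},\mu_{i+1})\le\min(\lambda_i,\mu_i)$ for $1\le i<n$. In that case $tp+(1-t)q$ is real-rooted for every $t\in[0,1]$. Strong majorization: for $p,q$ with a common interlacer, let $\lambda_1(t)\ge\dots\ge\lambda_n(t)$ be the roots of $tp+(1-t)q$ and $S_k(t)=\sum_{i=1}^k\lambda_i(t)$, $t\in[0,1]$. Then $p\succeq^s q$ means that $sp+(1-s)q\succeq tp+(1-t)q$ for all $0\le t\le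 s\le 1$; that is, each $S_k$ is nondecreasing on $[0,1]$ and $S_n$ is constant. *)

theory Defs
  imports "HOL-Analysis.Analysis" "HOL-Computational_Algebra.Polynomial"
begin

text \<open>Note that the zero polynomial is not real-rooted, while nonzero constants are.\<close>

definition real_rooted :: "real poly \<Rightarrow> bool" where
  "real_rooted p \<longleftrightarrow>
     (\<forall>z::complex. poly (map_poly complex_of_real p) z = 0 \<longrightarrow> z \<in> \<real>)"

text \<open>The roots are numbered from 1: \<open>ordered_root p 1 \<ge> \<dots> \<ge> ordered_root p (degree p)\<close>, with
  multiplicity. Only indices in this range are meaningful, and only for real-rooted \<open>p\<close>.\<close>

definition ordered_root :: "real poly \<Rightarrow> nat \<Rightarrow> real" where
  "ordered_root p i = rev (sorted_list_of_multiset (proots p)) ! (i - 1)"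

text \<open>\<open>majorizes n a b\<close> is meant for vectors \<open>a 1 \<ge> \<dots> \<ge> a n\<close> and \<open>b 1 \<ge> \<dots> \<ge> b n\<close>.\<close>

definition majorizes :: "nat \<Rightarrow> (nat \<Rightarrow> real) \<Rightarrow> (nat \<Rightarrow> real) \<Rightarrow> bool" where
  "majorizes n a b \<longleftrightarrow>
     (\<forall>k\<le>n. (\<Sum>i=1..k. a i) \<ge> (\<Sum>i=1..k. b i)) \<and> (\<Sum>i=1..n. a i) = (\<Sum>i=1..n. b i)"

definition poly_majorizes :: "real poly \<Rightarrow> real poly \<Rightarrow> bool" where
  "poly_majorizes p q \<longleftrightarrow>
     real_rooted p \<and> real_rooted q \<and> degree p = degree q \<and>
     majorizes (degree p) (ordered_root p) (ordered_root q)"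

definition common_interlacer :: "real poly \<Rightarrow> real poly \<Rightarrow> bool" where
  "common_interlacer p q \<longleftrightarrow>
     real_rooted p \<and> real_rooted q \<and> degree p = degree q \<and>
     (\<forall>i. 1 \<le> i \<and> i < degree p \<longrightarrow>
        max (ordered_root p (i + 1)) (ordered_root q (i + 1))
          \<le> min (ordered_root p i) (ordered_root q i))"

definition strongly_majorizes :: "real poly \<Rightarrow> real poly \<Rightarrow> bool" where
  "strongly_majorizes p q \<longleftrightarrow>
     common_interlacer p q \<and>
     (\<forall>s t. 0 \<le> t \<and> t \<le> s \<and> s \<le> 1 \<longrightarrow>
        poly_majorizes (smult s p + smult (1 - s) q) (smult t p + smult (1 - t) q))"

text \<open>The non-crossing condition in \<open>common_interlacer\<close> says that some third polynomial
  interlaces both: see \<open>common_interlacer_iff\<close> below.\<close>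

definition interlaces :: "real poly \<Rightarrow> real poly \<Rightarrow> bool" where
  "interlaces r p \<longleftrightarrow>
     real_rooted r \<and> real_rooted p \<and> degree p = degree r + 1 \<and>
     (\<forall>i. 1 \<le> i \<and> i \<le> degree r \<longrightarrow>
        ordered_root p (i + 1) \<le> ordered_root r i \<and> ordered_root r i \<le> ordered_root p i)"

lemma prod_linear_factors:
  fixes xs :: "real list"
  assumes "sorted_wrt (\<ge>) xs"
  defines "r \<equiv> (\<Prod>x\<leftarrow>xs. [:-x, 1:])"
  shows "degree r = length xs" "real_rooted r"
    "\<And>i. 1 \<le> i \<Longrightarrow> i \<le> length xs \<Longrightarrow> ordered_root r i = xs ! (i - 1)"
proof -
  have *: "(\<Prod>x\<leftarrow>ys. [:-x, 1:]) \<noteq> 0 \<and> degree (\<Prod>x\<leftarrow>ys. [:-x, 1:]) = length ys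
      \<and> proots (\<Prod>x\<leftarrow>ys. [:-x, 1:]) = mset ys" for ys :: "real list"
    by (induction ys) (auto simp: degree_mult_eq proots_mult simp del: mult_pCons_left)
  show "degree r = length xs"
    using * by (simp add: r_def)
  have [simp]: "map_poly complex_of_real (f * g) = map_poly complex_of_real f * map_poly complex_of_real g"
    for f g
    by (rule poly_eqI) (simp add: coeff_map_poly coeff_mult)
  have "map_poly complex_of_real (\<Prod>x\<leftarrow>ys. [:-x, 1:]) = (\<Prod>x\<leftarrow>ys. [:- complex_of_real x, 1:])"
    for ys :: "real list"
    by (induction ys) (simp_all add: map_poly_pCons del: mult_pCons_left)
  moreover have "poly (\<Prod>x\<leftarrow>ys. [:- complex_of_real x, 1:]) z = (\<Prod>x\<leftarrow>ys. z - complex_of_real x)"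
    for ys z
    by (induction ys) (simp_all del: mult_pCons_left)
  ultimately have "poly (map_poly complex_of_real r) z = (\<Prod>x\<leftarrow>xs. z - complex_of_real x)" for z
    by (simp add: r_def)
  then show "real_rooted r"
    by (auto simp: real_rooted_def prod_list_zero_iff)
  have "sorted (rev xs)"
    using assms(1) by (simp add: sorted_wrt_rev)
  then have "rev (sorted_list_of_multiset (proots r)) = xs"
    using * [of xs] sorted_list_of_multiset_mset [of "rev xs"] by (simp add: r_def sorted_sort_id)
  then show "ordered_root r i = xs ! (i - 1)" for i
    by (simp add: ordered_root_def)
qed

lemma common_interlacer_iff:
  assumes "degree p > 0"
  shows "common_interlacer p q \<longleftrightarrow> (\<exists>r. interlaces r p \<and> interlaces r q)"
proof
  assume ci: "common_interlacer p q"
  define m where "m = degree p - 1"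
  define nu where "nu i = max (ordered_root p (i + 2)) (ordered_root q (i + 2))" for i
  define xs where "xs = map nu [0..<m]"
  have nc: "max (ordered_root p (i + 1)) (ordered_root q (i + 1))
      \<le> min (ordered_root p i) (ordered_root q i)" if "1 \<le> i" "i \<le> m" for i
    using ci that by (simp add: common_interlacer_def m_def)
  have step: "nu (Suc i) \<le> nu i" if "Suc i < m" for i
    using nc [of "i + 2"] that by (auto simp: nu_def numeral_eq_Suc le_max_iff_disj)
  have mono: "nu j \<le> nu i" if "i \<le> j" "j < m" for i j
    using that
  proof (induction j)
    case (Suc j)
    then show ?case using step [of j] by (cases "i = Suc j") force+
  qed auto
  have "sorted_wrt (\<ge>) xs"
    using mono by (auto simp: xs_def sorted_wrt_iff_nth_less)
  note r = prod_linear_factors [OF this]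
  have "ordered_root (\<Prod>x\<leftarrow>xs. [:-x, 1:]) i =
      max (ordered_root p (i + 1)) (ordered_root q (i + 1))" if "1 \<le> i" "i \<le> m" for i
    using r(3) [of i] that by (cases i) (simp_all add: xs_def nu_def)
  moreover have "ordered_root p (i + 1) \<le> ordered_root p i \<and> ordered_root p (i + 1) \<le> ordered_root q i
      \<and> ordered_root q (i + 1) \<le> ordered_root p i \<and> ordered_root q (i + 1) \<le> ordered_root q i"
    if "1 \<le> i" "i \<le> m" for i
    using nc [OF that] by simp
  moreover have "degree (\<Prod>x\<leftarrow>xs. [:-x, 1:]) = m" "degree p = m + 1" "degree q = m + 1"
    using r(1) ci assms by (simp_all add: xs_def m_def common_interlacer_def)
  ultimately have "interlaces (\<Prod>x\<leftarrow>xs. [:-x, 1:]) p \<and> interlaces (\<Prod>x\<leftarrow>xs. [:-x, 1:]) q"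
    using r(2) ci unfolding interlaces_def common_interlacer_def by simp
  then show "\<exists>r. interlaces r p \<and> interlaces r q" by blast
next
  assume "\<exists>r. interlaces r p \<and> interlaces r q"
  then obtain r where "interlaces r p" "interlaces r q" by blast
  then show "common_interlacer p q"
    unfolding interlaces_def common_interlacer_def
    by (auto simp: less_Suc_eq_le intro: order_trans)
qed

end

theory Submission
  imports Defs "HOL-Computational_Algebra.Fundamental_Theorem_Algebra"
begin

text \<open>
  Let \<open>r\<^sub>t = t p + (1 - t) q\<close> and suppose at first that \<open>p\<close> and \<open>q\<close> have no common root. Then the intervals
  between \<open>\<lambda>\<^sub>i\<close> and \<open>\<mu>\<^sub>i\<close> are disjoint, each contains exactly one root \<open>\<lambda>\<^sub>i(t)\<close> of \<open>r\<^sub>t\<close>, and this root moves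
  with velocity \<open>c\<^sub>i(t)\<close>, the residue of \<open>(q - p) / r\<^sub>t\<close> at \<open>\<lambda>\<^sub>i(t)\<close>. So the sum of the \<open>k\<close> largest roots has
  derivative \<open>C\<^sub>k(t) = c\<^sub>1(t) + \<dots> + c\<^sub>k(t)\<close>. At \<open>t = 1\<close> this is the sum in the criterion, hence necessity.

  For sufficiency, nonnegativity of all \<open>C\<^sub>k\<close> has to propagate from \<open>t = 1\<close> down to \<open>t = 0\<close>, given
  \<open>C\<^sub>n = 0\<close>. The velocities satisfy \<open>c\<^sub>i' = 2 c\<^sub>i \<Sum>\<^sub>j c\<^sub>j / (\<lambda>\<^sub>i - \<lambda>\<^sub>j)\<close> (sum over \<open>j \<noteq> i\<close>), so that
  \<open>C\<^sub>k'\<close> is twice the sum of \<open>c\<^sub>i c\<^sub>j / (\<lambda>\<^sub>i - \<lambda>\<^sub>j)\<close> over \<open>i \<le> k < j\<close>. Summation by parts in both indices turns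
  this into a quadratic form in the \<open>C\<^sub>i\<close> in which all terms without \<open>C\<^sub>k\<close> have nonpositive coefficients,
  because the kernel \<open>1 / (x - y)\<close> has nonpositive mixed differences. So a vanishing \<open>C\<^sub>k\<close> cannot
  become negative when time runs backwards. To make this rigorous without a theory of differential
  inequalities, the argument uses an exact version of the equation for two times \<open>s < t\<close>
  (\<open>cum_difference\<close>, from the partial fraction identity \<open>cauchy_sum\<close>). It shows directly that nonnegativity
  at \<open>t\<close> implies nonnegativity at \<open>s\<close> whenever \<open>t - s\<close> is below a uniform bound (\<open>cum_nonneg_step\<close>); finitely
  many steps cover the unit interval.

  Common roots of \<open>p\<close> and \<open>q\<close> are roots of every \<open>r\<^sub>t\<close>, and the moving roots may cross them. They have
  velocity zero, so that removing them only deletes some of the partial sums and keeps the criterion;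
  interlacing survives because it can be expressed by counting roots above a level. The fixed roots are
  put back by describing majorization through sums of positive parts \<open>max (x - c) 0\<close>
  (\<open>poly_majorizes_hinge\<close>), to which they contribute a constant.
\<close>

section \<open>Polynomials given by their roots\<close>

definition monic_with_roots :: "'i set \<Rightarrow> ('i \<Rightarrow> real) \<Rightarrow> real poly" where
  "monic_with_roots I f = (\<Prod>i\<in>I. [:- f i, 1:])"

lemma poly_monic_with_roots: "poly (monic_with_roots I f) x = (\<Prod>i\<in>I. x - f i)"
  by (simp add: monic_with_roots_def poly_prod)

lemma degree_monic_with_roots [simp]: "degree (monic_with_roots I f) = card I"
  unfolding monic_with_roots_def
  by (cases "finite I") (simp_all add: degree_prod_eq_sum_degree)

lemma coeff_card_monic_with_roots [simp]: "coeff (monic_with_roots I f) (card I) = 1"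
proof -
  have "lead_coeff (monic_with_roots I f) = 1"
    by (simp add: monic_with_roots_def lead_coeff_prod del: degree_monic_with_roots)
  then show ?thesis
    by simp
qed

lemma proots_monic_with_roots:
  assumes "finite I"
  shows "proots (monic_with_roots I f) = image_mset f (mset_set I)"
  using assms unfolding monic_with_roots_def
  by (induction I) (simp_all add: proots_mult del: mult_pCons_left)

lemma coeff_pred_card_monic_with_roots:
  assumes "finite I" "I \<noteq> {}"
  shows "coeff (monic_with_roots I f) (card I - 1) = - (\<Sum>i\<in>I. f i)"
  using assms
proof (induction I rule: finite_ne_induct)
  case (singleton i)
  then show ?case by (simp add: monic_with_roots_def)
next
  case (insert i I)
  let ?P = "monic_with_roots I f"
  obtain k where k: "card I = Suc k"
    using insert by (metis card_0_eq not0_implies_Suc)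
  have "monic_with_roots (insert i I) f = [:- f i, 1:] * ?P"
    using insert by (simp add: monic_with_roots_def del: mult_pCons_left)
  then have "coeff (monic_with_roots (insert i I) f) (card I) =
      - f i * coeff ?P (card I) + coeff ?P (card I - 1)"
    by (simp add: k)
  then show ?case
    using insert by simp
qed

lemma poly_pderiv_monic_with_roots:
  assumes "finite I" "i \<in> I"
  shows "poly (pderiv (monic_with_roots I f)) (f i) = (\<Prod>j\<in>I - {i}. f i - f j)"
proof -
  have "poly (pderiv (monic_with_roots I f)) (f i) = (\<Sum>k\<in>I. \<Prod>j\<in>I - {k}. f i - f j)"
    by (simp add: monic_with_roots_def pderiv_prod poly_sum poly_prod pderiv_pCons)
  also have "\<dots> = (\<Sum>k\<in>I. if k = i then \<Prod>j\<in>I - {i}. f i - f j else 0)"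
    using assms by (intro sum.cong) auto
  finally show ?thesis
    using assms by simp
qed

lemma real_rooted_monic_with_roots:
  assumes "finite I"
  shows "real_rooted (monic_with_roots I f)"
proof -
  define xs where "xs = rev (sorted_list_of_multiset (image_mset f (mset_set I)))"
  have "sorted_wrt (\<ge>) xs"
    by (simp add: xs_def sorted_wrt_rev)
  then have "real_rooted (\<Prod>x\<leftarrow>xs. [:-x, 1:])"
    by (rule prod_linear_factors)
  moreover have "(\<Prod>x\<leftarrow>xs. [:-x, 1:]) = (\<Prod>x\<in>#mset xs. [:-x, 1:])"
    by (metis mset_map prod_mset_prod_list)
  moreover have "mset xs = image_mset f (mset_set I)"
    by (simp add: xs_def)
  ultimately show ?thesis
    by (simp add: monic_with_roots_def prod_unfold_prod_mset image_mset.compositionality comp_def)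
qed

text \<open>Real-rootedness is a statement about complex zeros, so a real zero to split off comes from the
  fundamental theorem of algebra.\<close>

lemma real_rooted_factorization:
  assumes "real_rooted p"
  shows "p = smult (lead_coeff p) (\<Prod>x\<in>#proots p. [:-x, 1:])"
  using assms
proof (induction "degree p" arbitrary: p rule: less_induct)
  case less
  let ?c = "map_poly complex_of_real"
  have mult: "?c (f * g) = ?c f * ?c g" for f g
    by (rule poly_eqI) (simp add: coeff_map_poly coeff_mult)
  show ?case
  proof (cases "degree p = 0")
    case True
    then show ?thesis
      by (auto elim!: degree_eq_zeroE)
  next
    case False
    then have "degree (?c p) > 0"
      by (simp add: degree_map_poly)
    then obtain z where z: "poly (?c p) z = 0"
      using fundamental_theorem_of_algebra [of "?c p"] by (auto simp: constant_degree)
    have "z \<in> \<real>"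
      using less.prems z unfolding real_rooted_def by blast
    then obtain x where "z = complex_of_real x"
      by (rule Reals_cases)
    moreover have "poly (?c p) (complex_of_real x) = complex_of_real (poly p x)"
      by (induction p) (simp_all add: map_poly_pCons)
    ultimately have "poly p x = 0"
      using z by simp
    then obtain q where q: "p = [:-x, 1:] * q"
      using poly_eq_0_iff_dvd by blast
    have "q \<noteq> 0"
      using q False by auto
    have "degree q < degree p"
      using \<open>q \<noteq> 0\<close> by (simp add: q degree_mult_eq del: mult_pCons_left)
    moreover have "real_rooted q"
      using less.prems by (auto simp: real_rooted_def q mult simp del: mult_pCons_left)
    ultimately have IH: "q = smult (lead_coeff q) (\<Prod>x\<in>#proots q. [:-x, 1:])"
      using less.hyps by blast
    have "lead_coeff p = lead_coeff q"
      by (simp add: q lead_coeff_mult del: mult_pCons_left)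
    moreover have "proots p = add_mset x (proots q)"
      using \<open>q \<noteq> 0\<close> by (simp add: q proots_mult del: mult_pCons_left)
    ultimately have "smult (lead_coeff p) (\<Prod>x\<in>#proots p. [:-x, 1:]) =
        [:-x, 1:] * smult (lead_coeff q) (\<Prod>x\<in>#proots q. [:-x, 1:])"
      by (simp del: mult_pCons_left)
    then show ?thesis
      using IH q by simp
  qed
qed

lemma simple_rooted_factorization:
  assumes "real_rooted p" "rsquarefree p" "lead_coeff p = 1"
  shows "p = monic_with_roots {x. poly p x = 0} (\<lambda>x. x)"
proof -
  have "p \<noteq> 0"
    using assms by auto
  then have "proots p = mset_set {x. poly p x = 0}"
    using assms(2) poly_roots_finite [of p]
    by (intro multiset_eqI) (force simp: count_mset_set' rsquarefree_def order_root)
  then show ?thesis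
    using real_rooted_factorization [OF assms(1)] assms(3)
    by (simp add: monic_with_roots_def prod_unfold_prod_mset)
qed

lemma lagrange_interpolation:
  fixes g :: "real poly" and y :: "'i \<Rightarrow> real"
  assumes "finite I" "inj_on y I" "degree g < card I"
  shows "g = (\<Sum>i\<in>I. smult (poly g (y i) / (\<Prod>j\<in>I - {i}. y i - y j)) (monic_with_roots (I - {i}) y))"
    (is "g = ?s")
proof (rule poly_eqI_degree [of "y ` I"])
  have card: "card (y ` I) = card I"
    using assms by (simp add: card_image)
  show "degree g < card (y ` I)"
    using assms card by simp
  have "degree ?s \<le> card I - 1"
    using assms by (intro degree_sum_le) (auto intro: order_trans [OF degree_smult_le])
  then show "degree ?s < card (y ` I)"
    using assms card by linarith
  fix x assume "x \<in> y ` I"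
  then obtain k where k: "k \<in> I" "x = y k" by blast
  have nz: "(\<Prod>j\<in>I - {k}. y k - y j) \<noteq> 0"
    using assms k by (auto simp: inj_on_def)
  have "poly ?s x = (\<Sum>i\<in>I. poly g (y i) / (\<Prod>j\<in>I - {i}. y i - y j) * (\<Prod>j\<in>I - {i}. y k - y j))"
    by (simp add: poly_sum poly_monic_with_roots k)
  also have "\<dots> = (\<Sum>i\<in>I. if i = k then poly g (y k) else 0)"
    using assms(1) k nz by (intro sum.cong) auto
  finally show "poly g x = poly ?s x"
    using assms(1) k by simp
qed

lemma partial_fractions:
  fixes g :: "real poly" and y :: "'i \<Rightarrow> real"
  assumes "finite I" "inj_on y I" "degree g < card I" and x: "x \<notin> y ` I"
  shows "(\<Sum>i\<in>I. poly g (y i) / (\<Prod>j\<in>I - {i}. y i - y j) / (x - y i))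
    = poly g x / poly (monic_with_roots I y) x"
proof -
  let ?c = "\<lambda>i. poly g (y i) / (\<Prod>j\<in>I - {i}. y i - y j)"
  have "poly g x = (\<Sum>i\<in>I. ?c i * (\<Prod>j\<in>I - {i}. x - y j))"
    by (subst lagrange_interpolation [OF assms(1-3)]) (simp add: poly_sum poly_monic_with_roots)
  moreover have "(\<Prod>j\<in>I. x - y j) = (x - y i) * (\<Prod>j\<in>I - {i}. x - y j)" if "i \<in> I" for i
    using assms(1) that by (rule prod.remove)
  moreover have "x - y i \<noteq> 0" if "i \<in> I" for i
    using x that by auto
  ultimately show ?thesis
    using assms(1) by (simp add: poly_monic_with_roots sum_divide_distrib)
qed

section \<open>Summation by parts\<close>

lemma summation_by_parts:
  fixes c f :: "nat \<Rightarrow> real"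
  assumes "(\<Sum>i<m. c i) = 0"
  shows "(\<Sum>i<m. c i * f i) = (\<Sum>i=1..<m. (\<Sum>l<i. c l) * (f (i - 1) - f i))"
proof -
  have "(\<Sum>i<n. c i * f i) = (\<Sum>i=1..<n. (\<Sum>l<i. c l) * (f (i - 1) - f i)) + (\<Sum>l<n. c l) * f (n - 1)"
    for n
  proof (induction n)
    case (Suc n)
    then show ?case
      by (cases n) (simp_all add: algebra_simps)
  qed simp
  then show ?thesis
    using assms by simp
qed

text \<open>With total sums zero there are no boundary terms, so the right-hand side involves only the proper
  partial sums and the mixed second differences of the kernel.\<close>

lemma summation_by_parts_2:
  fixes c d :: "nat \<Rightarrow> real" and K :: "nat \<Rightarrow> nat \<Rightarrow> real"
  assumes "(\<Sum>i<m. c i) = 0" "(\<Sum>j<m. d j) = 0"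
  shows "(\<Sum>i<m. \<Sum>j<m. c i * d j * K i j) =
    (\<Sum>i=1..<m. \<Sum>j=1..<m. (\<Sum>l<i. c l) * (\<Sum>l<j. d l) *
       (K (i - 1) (j - 1) - K i (j - 1) - K (i - 1) j + K i j))"
proof -
  define C D where "C i = (\<Sum>l<i. c l)" and "D j = (\<Sum>l<j. d l)" for i j
  have "(\<Sum>i<m. \<Sum>j<m. c i * d j * K i j) = (\<Sum>i<m. c i * (\<Sum>j<m. d j * K i j))"
    by (simp add: sum_distrib_left mult.assoc)
  also have "\<dots> = (\<Sum>i<m. c i * (\<Sum>j=1..<m. D j * (K i (j - 1) - K i j)))"
    unfolding D_def using summation_by_parts [OF assms(2)] by simp
  also have "\<dots> = (\<Sum>i=1..<m. C i *
      ((\<Sum>j=1..<m. D j * (K (i - 1) (j - 1) - K (i - 1) j))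
       - (\<Sum>j=1..<m. D j * (K i (j - 1) - K i j))))"
    unfolding C_def using summation_by_parts [OF assms(1)] by simp
  also have "\<dots> = (\<Sum>i=1..<m. \<Sum>j=1..<m. C i * D j *
       (K (i - 1) (j - 1) - K i (j - 1) - K (i - 1) j + K i j))"
    unfolding sum_subtractf [symmetric] sum_distrib_left
    by (intro sum.cong refl) (simp only: algebra_simps)
  finally show ?thesis
    by (simp add: C_def D_def)
qed

section \<open>Root curves of a pencil\<close>

text \<open>After removal of common roots, two interlacing root vectors span pairwise disjoint closed intervals
  \<open>Iv i\<close>, listed from right to left.\<close>

locale separated_roots =
  fixes m :: nat and a b :: "nat \<Rightarrow> real"
  assumes distinct: "i < m \<Longrightarrow> a i \<noteq> b i"
    and separated: "i < j \<Longrightarrow> j < m \<Longrightarrow> max (a j) (b j) < min (a i) (b i)"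
begin

abbreviation (input) Iv where "Iv i \<equiv> {min (a i) (b i)..max (a i) (b i)}"

definition P where "P = monic_with_roots {..<m} a"
definition Q where "Q = monic_with_roots {..<m} b"
definition R where "R t = smult t P + smult (1 - t) Q"

lemma poly_R: "poly (R t) x = t * poly P x + (1 - t) * poly Q x"
  by (simp add: R_def)

lemma R_1: "R 1 = P" 
  by (simp add: R_def)

lemma degree_R: "degree (R t) \<le> m"
  unfolding R_def by (intro degree_add_le order_trans [OF degree_smult_le]) (simp_all add: P_def Q_def)

lemma coeff_R: "coeff (R t) m = 1"
  using coeff_card_monic_with_roots [of "{..<m}"] by (simp add: R_def P_def Q_def)

text \<open>For \<open>j \<noteq> i\<close> the factors \<open>a i - b j\<close> and \<open>b i - a j\<close> have the same sign, because \<open>Iv i\<close> lies on one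
  side of \<open>Iv j\<close>; for \<open>j = i\<close> they are opposite numbers. This provides the sign change that puts a root
  of every \<open>R t\<close> into \<open>Iv i\<close>.\<close>

lemma opposite_signs:
  assumes "i < m"
  shows "poly Q (a i) * poly P (b i) \<le> 0"
proof -
  have "poly Q (a i) * poly P (b i) = (\<Prod>j<m. (a i - b j) * (b i - a j))"
    by (simp add: P_def Q_def poly_monic_with_roots prod.distrib)
  also have "\<dots> = - ((a i - b i)\<^sup>2 * (\<Prod>j\<in>{..<m} - {i}. (a i - b j) * (b i - a j)))"
    using assms by (subst prod.remove [of _ i]) (auto simp: power2_eq_square algebra_simps)
  also have "\<dots> \<le> 0"
  proof -
    have "(a i - b j) * (b i - a j) \<ge> 0" if "j < m" "j \<noteq> i" for j
      using separated [of i j] separated [of j i] assms that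
      by (cases "i < j") (auto intro!: mult_nonneg_nonneg mult_nonpos_nonpos)
    then have "(\<Prod>j\<in>{..<m} - {i}. (a i - b j) * (b i - a j)) \<ge> 0"
      by (intro prod_nonneg) auto
    then show ?thesis
      by simp
  qed
  finally show ?thesis .
qed

lemma root_in_interval:
  assumes "i < m" "0 \<le> t" "t \<le> 1"
  shows "\<exists>x\<in>Iv i. poly (R t) x = 0"
proof -
  have "poly P (a i) = 0" "poly Q (b i) = 0"
    using assms(1) by (auto simp: P_def Q_def poly_monic_with_roots)
  then have "poly (R t) (a i) * poly (R t) (b i) = (t * (1 - t)) * (poly Q (a i) * poly P (b i))"
    by (simp add: poly_R)
  also have "\<dots> \<le> 0"
    using assms by (intro mult_nonneg_nonpos [OF _ opposite_signs [OF assms(1)]]) auto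
  finally have sgn: "poly (R t) (a i) * poly (R t) (b i) \<le> 0" .
  define l u where "l = min (a i) (b i)" and "u = max (a i) (b i)"
  have "poly (R t) l * poly (R t) u \<le> 0" "l \<le> u"
    using sgn by (auto simp: l_def u_def min_def max_def mult.commute)
  moreover have cont: "continuous_on {l..u} (poly (R t))"
    by (intro continuous_intros)
  ultimately have "\<exists>x\<ge>l. x \<le> u \<and> poly (R t) x = 0"
    using IVT' [of "poly (R t)" l 0 u, OF _ _ _ cont] IVT2' [of "poly (R t)" u 0 l, OF _ _ _ cont]
    by (auto simp: mult_le_0_iff)
  then show ?thesis
    by (auto simp: l_def u_def)
qed

definition lam where "lam i t = (SOME x. x \<in> Iv i \<and> poly (R t) x = 0)"

lemma
  assumes "i < m" "0 \<le> t" "t \<le> 1"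
  shows lam_in: "lam i t \<in> Iv i" and poly_lam: "poly (R t) (lam i t) = 0"
proof -
  have "\<exists>x. x \<in> Iv i \<and> poly (R t) x = 0"
    using root_in_interval [OF assms] by blast
  from someI_ex [OF this] show "lam i t \<in> Iv i" "poly (R t) (lam i t) = 0"
    unfolding lam_def by blast+
qed

text \<open>The smallest gap between two of the intervals, capped at 1 so that it makes sense when there is at
  most one interval. It bounds the distance between roots uniformly in time.\<close>

definition \<delta> where
  "\<delta> = Min (insert 1 ((\<lambda>(i, j). min (a i) (b i) - max (a j) (b j)) ` {(i, j). i < j \<and> j < m}))"

lemma
  shows \<delta>_pos: "\<delta> > 0"
    and gap: "i < j \<Longrightarrow> j < m \<Longrightarrow> max (a j) (b j) + \<delta> \<le> min (a i) (b i)"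
proof -
  have "{(i, j). i < j \<and> j < m} \<subseteq> {..<m} \<times> {..<m}"
    by auto
  then have fin: "finite ((\<lambda>(i, j). min (a i) (b i) - max (a j) (b j)) ` {(i, j). i < j \<and> j < m})"
    by (meson finite_SigmaI finite_imageI finite_lessThan finite_subset)
  show "\<delta> > 0"
    unfolding \<delta>_def using fin separated by (subst Min_gr_iff) fastforce+
  show "max (a j) (b j) + \<delta> \<le> min (a i) (b i)" if "i < j" "j < m"
  proof -
    have "\<delta> \<le> min (a i) (b i) - max (a j) (b j)"
      unfolding \<delta>_def using fin that by (intro Min_le) (auto intro!: rev_image_eqI [of "(i, j)"])
    then show ?thesis by linarith
  qed
qed

lemma lam_gap:
  assumes "i < j" "j < m" "s \<in> {0..1}" "t \<in> {0..1}"
  shows "lam j s + \<delta> \<le> lam i t"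
  using lam_in [of j s] lam_in [of i t] gap [OF assms(1,2)] assms by auto

lemma lam_dist:
  assumes "i \<noteq> j" "i < m" "j < m" "s \<in> {0..1}" "t \<in> {0..1}"
  shows "\<delta> \<le> \<bar>lam i s - lam j t\<bar>"
  using lam_gap [of i j t s] lam_gap [of j i s t] assms by (cases "i < j") auto

lemma lam_inj:
  assumes "t \<in> {0..1}"
  shows "inj_on (\<lambda>i. lam i t) {..<m}"
  using lam_dist [of _ _ t t] \<delta>_pos assms by (fastforce simp: inj_on_def)

lemma R_eq:
  assumes "t \<in> {0..1}"
  shows "R t = monic_with_roots {..<m} (\<lambda>i. lam i t)"
proof (rule poly_eqI_degree_lead_coeff [where n = m and A = "(\<lambda>i. lam i t) ` {..<m}"])
  show "m \<le> card ((\<lambda>i. lam i t) ` {..<m})"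
    using lam_inj [OF assms] by (simp add: card_image)
  show "coeff (R t) m = coeff (monic_with_roots {..<m} (\<lambda>i. lam i t)) m"
    using coeff_card_monic_with_roots [of "{..<m}"] by (simp add: coeff_R)
next
  fix z assume "z \<in> (\<lambda>i. lam i t) ` {..<m}"
  then show "poly (R t) z = poly (monic_with_roots {..<m} (\<lambda>i. lam i t)) z"
    using poly_lam assms by (auto simp: poly_monic_with_roots)
qed (simp_all add: degree_R)

lemma lam_1:
  assumes "i < m"
  shows "lam i 1 = a i"
proof -
  have "poly P (lam i 1) = 0"
    using poly_lam [of i 1] assms by (simp add: R_1)
  then obtain j where j: "j < m" "lam i 1 = a j"
    by (auto simp: P_def poly_monic_with_roots)
  moreover have "j = i"
    using j lam_in [of i 1] separated [of i j] separated [of j i] assms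
    by (cases i j rule: linorder_cases) auto
  ultimately show ?thesis by simp
qed

lemma sum_lam:
  assumes "t \<in> {0..1}"
  shows "(\<Sum>i<m. lam i t) = t * (\<Sum>i<m. a i) + (1 - t) * (\<Sum>i<m. b i)"
proof (cases "m = 0")
  case False
  then have *: "{..<m} \<noteq> {}"
    by auto
  have "coeff (R t) (m - 1) = t * coeff P (m - 1) + (1 - t) * coeff Q (m - 1)"
    by (simp add: R_def)
  then show ?thesis
    using coeff_pred_card_monic_with_roots [of "{..<m}", OF _ *]
    by (simp add: R_eq [OF assms] P_def Q_def)
qed simp

text \<open>The residue of \<open>(Q - P) / R t\<close> at its \<open>i\<close>-th pole. It is also the velocity of the \<open>i\<close>-th root, see
  \<open>lam_has_derivative\<close> below; for \<open>t = 1\<close> it is the quotient in the criterion.\<close>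

definition vel where
  "vel i t = poly (Q - P) (lam i t) / (\<Prod>j\<in>{..<m} - {i}. lam i t - lam j t)"

lemma poly_R_lam:
  assumes "i < m" "s \<in> {0..1}"
  shows "poly (R t) (lam i s) = (s - t) * poly (Q - P) (lam i s)"
  using poly_lam [of i s] assms by (auto simp: poly_R algebra_simps)

lemma no_common_root: "poly P x \<noteq> 0 \<or> poly Q x \<noteq> 0"
proof (rule ccontr)
  assume "\<not> ?thesis"
  then obtain i j where "i < m" "j < m" "x = a i" "x = b j"
    by (auto simp: P_def Q_def poly_monic_with_roots)
  then show False
    using distinct [of j] separated [of i j] separated [of j i] by (cases i j rule: linorder_cases) auto
qed

lemma poly_Q_P_lam:
  assumes "i < m" "s \<in> {0..1}"
  shows "poly (Q - P) (lam i s) \<noteq> 0"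
  using poly_lam [of i s] assms no_common_root [of "lam i s"]
  by (auto simp: poly_R algebra_simps)

lemma lam_neq:
  assumes "i < m" "j < m" "s \<in> {0..1}" "t \<in> {0..1}" "s \<noteq> t"
  shows "lam i s \<noteq> lam j t"
  using poly_R_lam [of i s t] poly_Q_P_lam [of i s] poly_lam [of j t] assms by auto

lemma degree_Q_P: "degree (Q - P) < m \<or> m = 0"
proof (cases "m = 0")
  case False
  have "degree (Q - P) \<le> m - 1"
  proof (rule degree_le, intro allI impI)
    fix k assume k: "m - 1 < k"
    show "coeff (Q - P) k = 0"
    proof (cases "k = m")
      case True
      then show ?thesis
        using coeff_card_monic_with_roots [of "{..<m}"] by (simp add: P_def Q_def)
    next
      case False
      then show ?thesis
        using k by (simp add: P_def Q_def coeff_eq_0)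
    qed
  qed
  then show ?thesis
    using False by linarith
qed simp

text \<open>This is the partial fraction expansion of \<open>(Q - P) / R t\<close> at a root of \<open>R s\<close>, where
  \<open>R t = (s - t) (Q - P)\<close>. It couples the residues at one time to the roots at another.\<close>

lemma cauchy_sum:
  assumes "j < m" "s \<in> {0..1}" "t \<in> {0..1}" "s \<noteq> t"
  shows "(\<Sum>i<m. vel i t / (lam j s - lam i t)) = 1 / (s - t)"
proof -
  have "(\<Sum>i<m. vel i t / (lam j s - lam i t)) = poly (Q - P) (lam j s) / poly (R t) (lam j s)"
    unfolding vel_def R_eq [OF assms(3)]
    using degree_Q_P lam_inj assms lam_neq
    by (intro partial_fractions) auto
  then show ?thesis
    using poly_R_lam [of j s t] poly_Q_P_lam [of j s] assms by simp
qed

lemma bounded_Q_P: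
  obtains G where "G > 0" "\<And>i t. i < m \<Longrightarrow> t \<in> {0..1} \<Longrightarrow> \<bar>poly (Q - P) (lam i t)\<bar> \<le> G"
proof -
  define S where "S = (\<Union>i<m. Iv i)"
  have "compact (poly (Q - P) ` S)"
    unfolding S_def by (intro compact_continuous_image compact_UN continuous_intros) auto
  then obtain G where G: "G > 0" "\<And>y. y \<in> poly (Q - P) ` S \<Longrightarrow> norm y \<le> G"
    using compact_imp_bounded bounded_pos by metis
  have "lam i t \<in> S" if "i < m" "t \<in> {0..1}" for i t
    using lam_in [of i t] that unfolding S_def by auto
  then show ?thesis
    using G by (intro that [of G]) (auto simp del: poly_diff)
qed

lemma prod_lam_dist:
  assumes "i < m" "s \<in> {0..1}" "t \<in> {0..1}"
  shows "\<bar>\<Prod>j\<in>{..<m} - {i}. lam i s - lam j t\<bar> \<ge> \<delta> ^ (m - 1)"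
proof -
  have "(\<Prod>j\<in>{..<m} - {i}. \<delta>) \<le> (\<Prod>j\<in>{..<m} - {i}. \<bar>lam i s - lam j t\<bar>)"
    using lam_dist assms \<delta>_pos by (intro prod_mono) auto
  then show ?thesis
    using assms by (simp add: abs_prod)
qed

lemma prod_lam_nonzero:
  assumes "i < m" "s \<in> {0..1}" "t \<in> {0..1}"
  shows "(\<Prod>j\<in>{..<m} - {i}. lam i s - lam j t) \<noteq> 0"
proof -
  have "\<delta> ^ (m - 1) > 0"
    using \<delta>_pos by simp
  then show ?thesis
    using prod_lam_dist [OF assms] by linarith
qed

lemma bounded_vel:
  obtains B where "B > 0" "\<And>i t. i < m \<Longrightarrow> t \<in> {0..1} \<Longrightarrow> \<bar>vel i t\<bar> \<le> B"
proof -
  obtain G where G: "G > 0" "\<And>i t. i < m \<Longrightarrow> t \<in> {0..1} \<Longrightarrow> \<bar>poly (Q - P) (lam i t)\<bar> \<le> G"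
    using bounded_Q_P by blast
  show ?thesis
  proof (rule that [of "G / \<delta> ^ (m - 1)"])
    show "G / \<delta> ^ (m - 1) > 0"
      using G \<delta>_pos by simp
    show "\<bar>vel i t\<bar> \<le> G / \<delta> ^ (m - 1)" if "i < m" "t \<in> {0..1}" for i t
      unfolding vel_def abs_divide
      using G \<delta>_pos prod_lam_dist [of i t t] that by (intro frac_le) (auto simp del: poly_diff)
  qed
qed

text \<open>Evaluating \<open>R t\<close> at a root of \<open>R s\<close> gives the difference quotient exactly, so that differentiability
  reduces to continuity, and boundedness of the right-hand side already gives a Lipschitz bound.\<close>

lemma lam_quotient:
  assumes "i < m" "s \<in> {0..1}" "t \<in> {0..1}" "s \<noteq> t"
  shows "(lam i s - lam i t) / (s - t) =
    poly (Q - P) (lam i s) / (\<Prod>j\<in>{..<m} - {i}. lam i s - lam j t)"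
proof -
  let ?\<pi> = "\<Prod>j\<in>{..<m} - {i}. lam i s - lam j t"
  have "(lam i s - lam i t) * ?\<pi> = (s - t) * poly (Q - P) (lam i s)"
    using poly_R_lam [of i s t] assms
    by (simp add: R_eq poly_monic_with_roots prod.remove [of "{..<m}" i])
  moreover have "?\<pi> \<noteq> 0"
    using prod_lam_nonzero assms by blast
  ultimately show ?thesis
    using assms by (simp add: field_simps)
qed

lemma lam_has_derivative:
  assumes "i < m" "t \<in> {0..1}"
  shows "(lam i has_real_derivative vel i t) (at t within {0..1})"
proof -
  obtain G where G: "G > 0" "\<And>i t. i < m \<Longrightarrow> t \<in> {0..1} \<Longrightarrow> \<bar>poly (Q - P) (lam i t)\<bar> \<le> G"
    using bounded_Q_P by blast
  define L where "L = G / \<delta> ^ (m - 1)"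
  have near: "\<forall>\<^sub>F s in at t within {0..1}. s \<in> {0..1} \<and> s \<noteq> t"
    by (auto simp: eventually_at_filter)
  have lip: "\<bar>lam i s - lam i t\<bar> \<le> L * \<bar>s - t\<bar>" if "s \<in> {0..1}" "s \<noteq> t" for s
  proof -
    have "\<bar>(lam i s - lam i t) / (s - t)\<bar> \<le> L"
      unfolding lam_quotient [OF assms(1) that(1) assms(2) that(2)] abs_divide L_def
      using G \<delta>_pos prod_lam_dist [of i s t] that assms by (intro frac_le) (auto simp del: poly_diff)
    then show ?thesis
      using that by (simp add: abs_divide field_simps)
  qed
  have cont: "(lam i \<longlongrightarrow> lam i t) (at t within {0..1})"
  proof (rule LIM_zero_cancel, rule Lim_null_comparison)
    show "\<forall>\<^sub>F s in at t within {0..1}. norm (lam i s - lam i t) \<le> L * \<bar>s - t\<bar>"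
      using near by eventually_elim (use lip in auto)
    have "((\<lambda>s. L * \<bar>s - t\<bar>) \<longlongrightarrow> L * \<bar>t - t\<bar>) (at t within {0..1})"
      by (intro tendsto_intros)
    then show "((\<lambda>s. L * \<bar>s - t\<bar>) \<longlongrightarrow> 0) (at t within {0..1})"
      by simp
  qed
  have "(\<Prod>j\<in>{..<m} - {i}. lam i t - lam j t) \<noteq> 0"
    using prod_lam_nonzero assms by blast
  then have "((\<lambda>s. poly (Q - P) (lam i s) / (\<Prod>j\<in>{..<m} - {i}. lam i s - lam j t)) \<longlongrightarrow> vel i t) (at t within {0..1})"
    unfolding vel_def by (intro tendsto_intros cont)
  then have "((\<lambda>s. (lam i s - lam i t) / (s - t)) \<longlongrightarrow> vel i t) (at t within {0..1})"
    by (rule Lim_transform_eventually)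
      (use near in \<open>eventually_elim, use assms in \<open>simp add: lam_quotient\<close>\<close>)
  then show ?thesis
    by (simp add: has_field_derivative_iff)
qed

end

section \<open>Partial sums of the velocities stay nonnegative\<close>

text \<open>The Cauchy kernel restricted to pairs on opposite sides of the cut before index \<open>k\<close>.\<close>

definition cut_kernel where
  "cut_kernel k y x i j = (if i < k \<and> k \<le> j then 1 / (y i - x j) else 0 :: real)"

definition mixed_difference :: "(nat \<Rightarrow> nat \<Rightarrow> real) \<Rightarrow> nat \<Rightarrow> nat \<Rightarrow> real" where
  "mixed_difference K i j = K (i - 1) (j - 1) - K i (j - 1) - K (i - 1) j + K i j"

lemma mixed_difference_recip_nonpos:
  fixes p q r s :: real
  assumes "s \<le> r" "r < q" "q \<le> p"
  shows "1 / (p - r) - 1 / (q - r) - 1 / (p - s) + 1 / (q - s) \<le> 0"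
proof -
  have "1 / (p - r) - 1 / (q - r) = - ((p - q) / ((p - r) * (q - r)))"
    "1 / (q - s) - 1 / (p - s) = (p - q) / ((p - s) * (q - s))"
    using assms by (auto simp: divide_simps)
  moreover have "(p - q) / ((p - s) * (q - s)) \<le> (p - q) / ((p - r) * (q - r))"
    using assms by (intro divide_left_mono mult_mono mult_pos_pos) auto
  ultimately show ?thesis
    by linarith
qed

text \<open>On its block \<open>i < k \<le> j\<close> the kernel has nonpositive mixed differences. Along the two sides of the
  block, that is for exactly one index equal to \<open>k\<close>, the drop to zero outside leaves a first difference
  in the direction along the side, which is nonnegative.\<close>

lemma mixed_difference_cut_kernel:
  fixes x y :: "nat \<Rightarrow> real" and k :: nat
  assumes gap: "\<And>i j. i < j \<Longrightarrow> j < m \<Longrightarrow> x j + \<delta> \<le> y i" and "\<delta> > 0"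
    and decr: "\<And>i j. i < j \<Longrightarrow> j < m \<Longrightarrow> x j \<le> x i" "\<And>i j. i < j \<Longrightarrow> j < m \<Longrightarrow> y j \<le> y i"
    and i: "1 \<le> i" "i < m" and j: "1 \<le> j" "j < m"
  defines "w \<equiv> mixed_difference (cut_kernel k y x) i j"
  shows "i \<noteq> k \<Longrightarrow> j \<noteq> k \<Longrightarrow> w \<le> 0" and "(i = k) \<noteq> (j = k) \<Longrightarrow> w \<ge> 0" and "\<bar>w\<bar> \<le> 4 / \<delta>"
proof -
  obtain i' j' where ij: "i = Suc i'" "j = Suc j'"
    using i j by (cases i; cases j) auto
  have recip_mono: "1 / (p - r) \<le> 1 / (q - s)" if "s + \<delta> \<le> q" "q \<le> p" "r \<le> s" for p q r s :: real
    using that \<open>\<delta> > 0\<close> by (intro divide_left_mono mult_pos_pos) auto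
  show "w \<le> 0" if "i \<noteq> k" "j \<noteq> k"
  proof (cases "i < k \<and> k < j")
    case True
    then have "w = 1 / (y i' - x j') - 1 / (y i - x j') - 1 / (y i' - x j) + 1 / (y i - x j)"
      by (auto simp: w_def mixed_difference_def cut_kernel_def ij)
    also have "\<dots> \<le> 0"
      using True gap [of i j'] decr(1) [of j' j] decr(2) [of i' i] \<open>\<delta> > 0\<close> i j ij
      by (intro mixed_difference_recip_nonpos) auto
    finally show ?thesis .
  next
    case False
    then have "w = 0"
      using that by (auto simp: w_def mixed_difference_def cut_kernel_def ij)
    then show ?thesis by simp
  qed
  show "w \<ge> 0" if "(i = k) \<noteq> (j = k)"
  proof -
    consider "i = k" "j < k" | "i = k" "k < j" | "j = k" "i < k" | "j = k" "k < i"
      using \<open>(i = k) \<noteq> (j = k)\<close> by linarith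
    then show ?thesis
    proof cases
      case 2
      then have "w = 1 / (y i' - x j') - 1 / (y i' - x j)"
        by (auto simp: w_def mixed_difference_def cut_kernel_def ij)
      then show ?thesis
        using recip_mono [of "x j'" "y i'" "y i'" "x j"] gap [of i' j'] decr(1) [of j' j] 2 i j ij by auto
    next
      case 3
      then have "w = 1 / (y i - x j) - 1 / (y i' - x j)"
        by (auto simp: w_def mixed_difference_def cut_kernel_def ij)
      then show ?thesis
        using recip_mono [of "x j" "y i" "y i'" "x j"] gap [of i j] decr(2) [of i' i] 3 i j ij by auto
    qed (auto simp: w_def mixed_difference_def cut_kernel_def ij)
  qed
  have bound: "0 \<le> cut_kernel k y x i j \<and> cut_kernel k y x i j \<le> 1 / \<delta>" if "j < m" for i j
    using gap [of i j] that \<open>\<delta> > 0\<close> by (auto simp: cut_kernel_def intro!: divide_left_mono mult_pos_pos)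
  show "\<bar>w\<bar> \<le> 4 / \<delta>"
  proof -
    have "j - 1 < m" "4 / \<delta> = 4 * (1 / \<delta>)"
      using j by auto
    then show ?thesis
      using bound [OF j(2), of i] bound [OF j(2), of "i - 1"] bound [of "j - 1" i] bound [of "j - 1" "i - 1"]
      unfolding w_def mixed_difference_def by linarith
  qed
qed

text \<open>The sign pattern is used as follows: a product \<open>C i * D j\<close> can contribute substantially only through
  \<open>C k\<close> or through the negative part of \<open>D\<close>. Terms containing \<open>D k\<close> but not \<open>C k\<close> have the right sign.\<close>

lemma bilinear_form_bound:
  fixes C D :: "nat \<Rightarrow> real" and w :: "nat \<Rightarrow> nat \<Rightarrow> real"
  assumes "finite I" "k \<in> I"
    and C: "\<And>i. i \<in> I \<Longrightarrow> 0 \<le> C i" "\<And>i. i \<in> I \<Longrightarrow> C i \<le> \<beta>"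
    and D: "\<And>i. i \<in> I \<Longrightarrow> - N \<le> D i" "\<And>i. i \<in> I \<Longrightarrow> \<bar>D i\<bar> \<le> \<beta>" "D k \<le> 0"
    and N: "0 \<le> N"
    and w: "\<And>i j. i \<in> I \<Longrightarrow> j \<in> I \<Longrightarrow> i \<noteq> k \<Longrightarrow> j \<noteq> k \<Longrightarrow> w i j \<le> 0"
      "\<And>i. i \<in> I \<Longrightarrow> i \<noteq> k \<Longrightarrow> w i k \<ge> 0"
      "\<And>i j. i \<in> I \<Longrightarrow> j \<in> I \<Longrightarrow> \<bar>w i j\<bar> \<le> \<kappa>"
  shows "(\<Sum>i\<in>I. \<Sum>j\<in>I. C i * D j * w i j) \<le> (card I)\<^sup>2 * (\<beta> * \<kappa> * (N + C k))"
proof -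
  have pos: "0 \<le> \<beta>" "0 \<le> \<kappa>" "0 \<le> C k"
    using C [OF assms(2)] w(3) [OF assms(2,2)] assms(2) by linarith+
  have "C i * D j * w i j \<le> \<beta> * \<kappa> * (N + C k)" if ij: "i \<in> I" "j \<in> I" for i j
  proof -
    consider "i = k" | "i \<noteq> k" "j = k" | "i \<noteq> k" "j \<noteq> k"
      by blast
    then show ?thesis
    proof cases
      case 1
      have "D j * w i j \<le> \<bar>D j\<bar> * \<bar>w i j\<bar>"
        by (metis abs_ge_self abs_mult)
      also have "\<dots> \<le> \<beta> * \<kappa>"
        using D(2) w(3) ij pos by (intro mult_mono) auto
      finally have "C k * (D j * w i j) \<le> C k * (\<beta> * \<kappa>)"
        using pos by (intro mult_left_mono)
      moreover have "0 \<le> \<beta> * \<kappa> * N"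
        using pos N by simp
      ultimately show ?thesis
        using 1 by (simp add: algebra_simps)
    next
      case 2
      have "C i * D j \<le> 0"
        using C ij D(3) 2 by (simp add: mult_nonneg_nonpos)
      then have "C i * D j * w i j \<le> 0"
        using w(2) ij 2 by (simp add: mult_nonpos_nonneg)
      also have "0 \<le> \<beta> * \<kappa> * (N + C k)"
        using pos N by simp
      finally show ?thesis .
    next
      case 3
      have "D j * w i j = (- D j) * (- w i j)"
        by simp
      also have "\<dots> \<le> N * (- w i j)"
        using D(1) [OF ij(2)] w(1) [OF ij 3] by (intro mult_right_mono) auto
      also have "\<dots> \<le> N * \<kappa>"
        using w(3) [OF ij] N by (intro mult_left_mono) auto
      finally have "C i * (D j * w i j) \<le> C i * (N * \<kappa>)"
        using C [OF ij(1)] by (intro mult_left_mono)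
      also have "\<dots> \<le> \<beta> * (N * \<kappa>)"
        using C [OF ij(1)] N pos by (intro mult_right_mono) auto
      finally have "C i * (D j * w i j) \<le> \<beta> * (N * \<kappa>)" .
      moreover have "0 \<le> \<beta> * \<kappa> * C k"
        using pos by simp
      ultimately show ?thesis
        by (simp add: algebra_simps)
    qed
  qed
  then have "(\<Sum>i\<in>I. \<Sum>j\<in>I. C i * D j * w i j) \<le> (\<Sum>i\<in>I. \<Sum>j\<in>I. \<beta> * \<kappa> * (N + C k))"
    by (intro sum_mono)
  then show ?thesis
    by (simp add: power2_eq_square)
qed

context separated_roots
begin

text \<open>The velocity of the sum of the \<open>k\<close> largest roots.\<close>

definition cum where "cum k t = (\<Sum>i<k. vel i t)"

text \<open>Both sides are the coefficient of degree \<open>m - 1\<close> in \<open>Q - P\<close>.\<close>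

lemma sum_vel:
  assumes "t \<in> {0..1}"
  shows "cum m t = (\<Sum>i<m. a i) - (\<Sum>i<m. b i)"
proof (cases "m = 0")
  case False
  then have *: "{..<m} \<noteq> {}"
    by auto
  have "Q - P = (\<Sum>i<m. smult (vel i t) (monic_with_roots ({..<m} - {i}) (\<lambda>i. lam i t)))"
    unfolding vel_def using lam_inj [OF assms] degree_Q_P False by (intro lagrange_interpolation) auto
  then have "coeff (Q - P) (m - 1) = (\<Sum>i<m. vel i t *
      coeff (monic_with_roots ({..<m} - {i}) (\<lambda>i. lam i t)) (m - 1))"
    by (simp add: coeff_sum)
  also have "\<dots> = cum m t"
    unfolding cum_def
  proof (rule sum.cong)
    show "vel i t * coeff (monic_with_roots ({..<m} - {i}) (\<lambda>i. lam i t)) (m - 1) = vel i t"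
      if "i \<in> {..<m}" for i
    proof -
      have "card ({..<m} - {i}) = m - 1"
        using that by simp
      then show ?thesis
        using coeff_card_monic_with_roots [of "{..<m} - {i}" "\<lambda>i. lam i t"] by (simp only: mult_1_right)
    qed
  qed simp
  finally show ?thesis
    using coeff_pred_card_monic_with_roots [of "{..<m}", OF _ *] by (simp add: P_def Q_def)
next
  case True
  then show ?thesis
    unfolding cum_def by simp
qed

text \<open>Multiply \<open>cauchy_sum\<close> at time \<open>t\<close> by the velocities at time \<open>s\<close>, and vice versa, and add up over the first
  \<open>k\<close> indices. The pairs with both indices below \<open>k\<close> cancel in the difference. For \<open>s \<rightarrow> t\<close> this becomes
  the differential equation of the partial sums; the exact form makes the comparison of two times
  possible without solving it.\<close>

lemma cum_difference:
  assumes st: "s \<in> {0..1}" "t \<in> {0..1}" "s \<noteq> t" and k: "k \<le> m"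
  shows "(cum k t - cum k s) / (t - s) =
    (\<Sum>i<m. \<Sum>j<m. vel i t * vel j s * cut_kernel k (\<lambda>i. lam i t) (\<lambda>j. lam j s) i j) +
    (\<Sum>i<m. \<Sum>j<m. vel i s * vel j t * cut_kernel k (\<lambda>i. lam i s) (\<lambda>j. lam j t) i j)"
proof -
  define T where "T i j = vel i t * vel j s / (lam i t - lam j s)" for i j
  have T_col: "(\<Sum>i<m. T i j) = - vel j s / (s - t)" if "j < m" for j
  proof -
    have "(\<Sum>i<m. T i j) = - vel j s * (\<Sum>i<m. vel i t / (lam j s - lam i t))"
      unfolding sum_distrib_left
    proof (rule sum.cong)
      fix i assume "i \<in> {..<m}"
      then have "lam i t \<noteq> lam j s"
        using lam_neq [of i j t s] st that by auto
      then show "T i j = - vel j s * (vel i t / (lam j s - lam i t))"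
        by (simp add: T_def field_simps)
    qed simp
    then show ?thesis
      using cauchy_sum [OF that st] by simp
  qed
  have T_row: "(\<Sum>j<m. T i j) = vel i t / (t - s)" if "i < m" for i
  proof -
    have "(\<Sum>j<m. T i j) = vel i t * (\<Sum>j<m. vel j s / (lam i t - lam j s))"
      unfolding sum_distrib_left by (simp add: T_def)
    then show ?thesis
      using cauchy_sum [of i t s] that st by simp
  qed
  \<comment> \<open>\<open>X\<close> and \<open>Y\<close> collect the pairs on opposite sides of the cut, and \<open>Z\<close> those on the near side.\<close>
  define X Y Z where "X = (\<Sum>i<k. \<Sum>j=k..<m. T i j)" and "Y = (\<Sum>i=k..<m. \<Sum>j<k. T i j)"
    and "Z = (\<Sum>i<k. \<Sum>j<k. T i j)"
  have split: "(\<Sum>i<m. f i) = (\<Sum>i<k. f i) + (\<Sum>i=k..<m. f i)" for f :: "nat \<Rightarrow> real"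
    using k sum.atLeastLessThan_concat [of 0 k m f] by (simp add: atLeast0LessThan)
  have "(\<Sum>i<k. \<Sum>j<m. T i j) = Z + X"
    unfolding split by (simp add: X_def Z_def sum.distrib)
  moreover have "(\<Sum>j<k. \<Sum>i<m. T i j) = Z + Y"
  proof -
    have "(\<Sum>j<k. \<Sum>i=k..<m. T i j) = Y" "(\<Sum>j<k. \<Sum>i<k. T i j) = Z"
      unfolding Y_def Z_def by (rule sum.swap)+
    then show ?thesis
      unfolding split by (simp add: sum.distrib)
  qed
  moreover have "(\<Sum>i<k. \<Sum>j<m. T i j) = cum k t / (t - s)"
    using T_row k by (simp add: cum_def sum_divide_distrib)
  moreover have "(\<Sum>j<k. \<Sum>i<m. T i j) = cum k s / (t - s)"
  proof -
    have "(\<Sum>j<k. \<Sum>i<m. T i j) = (\<Sum>j<k. vel j s / (t - s))"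
      using T_col k by (intro sum.cong) (auto simp: minus_divide_right)
    then show ?thesis
      by (simp add: cum_def sum_divide_distrib)
  qed
  ultimately have "(cum k t - cum k s) / (t - s) = X - Y"
    by (simp add: diff_divide_distrib)
  moreover have "X = (\<Sum>i<m. \<Sum>j<m. vel i t * vel j s * cut_kernel k (\<lambda>i. lam i t) (\<lambda>j. lam j s) i j)"
    unfolding split by (simp add: X_def T_def cut_kernel_def)
  moreover have "- Y = (\<Sum>i<m. \<Sum>j<m. vel i s * vel j t * cut_kernel k (\<lambda>i. lam i s) (\<lambda>j. lam j t) i j)"
  proof -
    have "- T j i = vel i s * vel j t / (lam i s - lam j t)" for i j
      unfolding T_def by (metis (no_types) minus_diff_eq minus_divide_right mult.commute)
    moreover have "- Y = (\<Sum>i<k. \<Sum>j=k..<m. - T j i)"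
      unfolding Y_def sum_negf by (subst sum.swap) simp
    ultimately show ?thesis
      unfolding split by (simp add: cut_kernel_def)
  qed
  ultimately show ?thesis
    by simp
qed

lemma cum_difference_by_parts:
  assumes st: "s \<in> {0..1}" "t \<in> {0..1}" "s \<noteq> t" and k: "k \<le> m"
    and sums: "(\<Sum>i<m. a i) = (\<Sum>i<m. b i)"
  shows "(cum k t - cum k s) / (t - s) =
    (\<Sum>i=1..<m. \<Sum>j=1..<m. cum i t * cum j s *
      mixed_difference (cut_kernel k (\<lambda>i. lam i t) (\<lambda>j. lam j s)) i j) +
    (\<Sum>i=1..<m. \<Sum>j=1..<m. cum i t * cum j s *
      mixed_difference (cut_kernel k (\<lambda>i. lam i s) (\<lambda>j. lam j t)) j i)"
proof -
  have z: "(\<Sum>i<m. vel i s) = 0" "(\<Sum>i<m. vel i t) = 0"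
    using sum_vel [of s] sum_vel [of t] st sums by (auto simp: cum_def)
  have "(\<Sum>i=1..<m. \<Sum>j=1..<m. cum i t * cum j s *
      mixed_difference (cut_kernel k (\<lambda>i. lam i s) (\<lambda>j. lam j t)) j i) =
    (\<Sum>i=1..<m. \<Sum>j=1..<m. cum i s * cum j t *
      mixed_difference (cut_kernel k (\<lambda>i. lam i s) (\<lambda>j. lam j t)) i j)"
    by (subst sum.swap) (simp add: mult.commute)
  then show ?thesis
    unfolding cum_difference [OF st k] summation_by_parts_2 [OF z(2,1)] summation_by_parts_2 [OF z]
    by (simp add: cum_def mixed_difference_def)
qed

lemma lam_kernel_signs:
  fixes k :: nat
  assumes "s \<in> {0..1}" "t \<in> {0..1}" "i \<in> {1..<m}" "j \<in> {1..<m}"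
  defines "w \<equiv> mixed_difference (cut_kernel k (\<lambda>i. lam i t) (\<lambda>j. lam j s)) i j"
  shows "i \<noteq> k \<Longrightarrow> j \<noteq> k \<Longrightarrow> w \<le> 0" and "(i = k) \<noteq> (j = k) \<Longrightarrow> w \<ge> 0" and "\<bar>w\<bar> \<le> 4 / \<delta>"
proof -
  have gap': "lam j s + \<delta> \<le> lam i t" if "i < j" "j < m" for i j
    using lam_gap [OF that] assms(1,2) by blast
  have decr: "lam j s \<le> lam i s" "lam j t \<le> lam i t" if "i < j" "j < m" for i j
    using lam_gap [OF that, of s s] lam_gap [OF that, of t t] assms(1,2) \<delta>_pos by auto
  have ij: "1 \<le> i" "i < m" "1 \<le> j" "j < m"
    using assms(3,4) by auto
  note signs = mixed_difference_cut_kernel [where m = m and \<delta> = \<delta> and x = "\<lambda>j. lam j s" and y = "\<lambda>i. lam i t",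
      OF gap' \<delta>_pos decr ij]
  show "w \<le> 0" if "i \<noteq> k" "j \<noteq> k"
    unfolding w_def using signs(1) that by blast
  show "w \<ge> 0" if "(i = k) \<noteq> (j = k)"
    unfolding w_def using signs(2) that by blast
  show "\<bar>w\<bar> \<le> 4 / \<delta>"
    unfolding w_def using signs(3) by blast
qed

text \<open>Let \<open>k\<close> minimize the partial sums at the earlier time \<open>s\<close>, with minimum \<open>- N < 0\<close>. By the sign
  pattern of the mixed differences, the loss \<open>cum k t + N\<close> is at most \<open>(t - s) * M * (N + cum k t)\<close>, which is
  absurd once \<open>(t - s) * M < 1\<close>. Since \<open>M\<close> depends only on the gaps and on a bound for the velocities,
  the step size is uniform.\<close>

lemma cum_nonneg_step:
  assumes sums: "(\<Sum>i<m. a i) = (\<Sum>i<m. b i)"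
  obtains h where "h > 0"
    "\<And>s t. s \<in> {0..1} \<Longrightarrow> t \<in> {0..1} \<Longrightarrow> s < t \<Longrightarrow> t - s \<le> h \<Longrightarrow>
      \<forall>k\<in>{1..<m}. cum k t \<ge> 0 \<Longrightarrow> \<forall>k\<in>{1..<m}. cum k s \<ge> 0"
proof -
  obtain B where B: "B > 0" "\<And>i t. i < m \<Longrightarrow> t \<in> {0..1} \<Longrightarrow> \<bar>vel i t\<bar> \<le> B"
    using bounded_vel by blast
  define \<beta> where "\<beta> = m * B"
  have \<beta>: "\<bar>cum k t\<bar> \<le> \<beta>" if "k < m" "t \<in> {0..1}" for k t
  proof -
    have "\<bar>cum k t\<bar> \<le> (\<Sum>i<k. \<bar>vel i t\<bar>)"
      unfolding cum_def by (rule sum_abs)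
    also have "\<dots> \<le> (\<Sum>i<k. B)"
      using B that by (intro sum_mono) auto
    also have "\<dots> \<le> \<beta>"
      using B that by (simp add: \<beta>_def)
    finally show ?thesis .
  qed
  have "\<beta> \<ge> 0"
    using B by (simp add: \<beta>_def)
  define M where "M = 2 * ((card {1..<m})\<^sup>2 * (\<beta> * (4 / \<delta>)))"
  have "M \<ge> 0"
    using \<open>\<beta> \<ge> 0\<close> \<delta>_pos by (simp add: M_def)
  show ?thesis
  proof (rule that [of "1 / (2 * (M + 1))"])
    show "1 / (2 * (M + 1)) > 0"
      using \<open>M \<ge> 0\<close> by simp
    fix s t :: real
    assume st: "s \<in> {0..1}" "t \<in> {0..1}" "s < t" "t - s \<le> 1 / (2 * (M + 1))"
      and pos: "\<forall>k\<in>{1..<m}. cum k t \<ge> 0"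
    show "\<forall>k\<in>{1..<m}. cum k s \<ge> 0"
    proof (rule ccontr)
      assume neg: "\<not> ?thesis"
      then have "{1..<m} \<noteq> {}"
        by auto
      then have "\<exists>k. is_arg_min (\<lambda>k. cum k s) (\<lambda>k. k \<in> {1..<m}) k"
        by (intro ex_is_arg_min_if_finite) simp_all
      then obtain k where k: "k \<in> {1..<m}" and kmin: "\<And>j. j \<in> {1..<m} \<Longrightarrow> cum k s \<le> cum j s"
        by (auto simp: is_arg_min_linorder)
      define N where "N = - cum k s"
      have "N > 0"
        using neg kmin unfolding N_def by force
      define E where "E = (cum k t - cum k s) / (t - s)"
      define w1 w2 where "w1 i j = mixed_difference (cut_kernel k (\<lambda>i. lam i t) (\<lambda>j. lam j s)) i j"
        and "w2 i j = mixed_difference (cut_kernel k (\<lambda>i. lam i s) (\<lambda>j. lam j t)) j i" for i j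
      have bound: "(\<Sum>i=1..<m. \<Sum>j=1..<m. cum i t * cum j s * w i j) \<le>
          (card {1..<m})\<^sup>2 * (\<beta> * (4 / \<delta>) * (N + cum k t))"
        if w: "\<And>i j. i \<in> {1..<m} \<Longrightarrow> j \<in> {1..<m} \<Longrightarrow> i \<noteq> k \<Longrightarrow> j \<noteq> k \<Longrightarrow> w i j \<le> 0"
          "\<And>i. i \<in> {1..<m} \<Longrightarrow> i \<noteq> k \<Longrightarrow> w i k \<ge> 0"
          "\<And>i j. i \<in> {1..<m} \<Longrightarrow> j \<in> {1..<m} \<Longrightarrow> \<bar>w i j\<bar> \<le> 4 / \<delta>" for w
      proof (rule bilinear_form_bound [OF _ k])
        fix i assume i: "i \<in> {1..<m}"
        show "0 \<le> cum i t"
          using pos i by blast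
        show "cum i t \<le> \<beta>" "\<bar>cum i s\<bar> \<le> \<beta>"
          using \<beta> [of i t] \<beta> [of i s] i st by auto
        show "- N \<le> cum i s"
          using kmin [OF i] by (simp add: N_def)
      next
        show "cum k s \<le> 0" "0 \<le> N"
          using \<open>N > 0\<close> by (simp_all add: N_def)
      qed (use w in auto)
      have E1: "(\<Sum>i=1..<m. \<Sum>j=1..<m. cum i t * cum j s * w1 i j) \<le>
          (card {1..<m})\<^sup>2 * (\<beta> * (4 / \<delta>) * (N + cum k t))"
        by (rule bound; unfold w1_def; rule lam_kernel_signs) (use st k in auto)
      have E2: "(\<Sum>i=1..<m. \<Sum>j=1..<m. cum i t * cum j s * w2 i j) \<le>
          (card {1..<m})\<^sup>2 * (\<beta> * (4 / \<delta>) * (N + cum k t))"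
        by (rule bound; unfold w2_def; rule lam_kernel_signs) (use st k in auto)
      have "E \<le> M * (N + cum k t)"
      proof -
        have "E = (\<Sum>i=1..<m. \<Sum>j=1..<m. cum i t * cum j s * w1 i j) +
            (\<Sum>i=1..<m. \<Sum>j=1..<m. cum i t * cum j s * w2 i j)"
          unfolding E_def w1_def w2_def using st k sums by (intro cum_difference_by_parts) auto
        also note add_mono [OF E1 E2]
        finally show ?thesis
          by (simp only: M_def mult.assoc mult_2 distrib_right)
      qed
      then have "(t - s) * E \<le> (t - s) * (M * (N + cum k t))"
        using st by (intro mult_left_mono) auto
      also have "\<dots> = ((t - s) * M) * (N + cum k t)"
        by simp
      also have "\<dots> \<le> (1 / 2) * (N + cum k t)"
      proof (rule mult_right_mono)
        have "(t - s) * M \<le> 1 / (2 * (M + 1)) * M"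
          using st \<open>M \<ge> 0\<close> by (intro mult_right_mono) auto
        also have "\<dots> \<le> 1 / 2"
          using \<open>M \<ge> 0\<close> by (simp add: divide_simps)
        finally show "(t - s) * M \<le> 1 / 2" .
        show "0 \<le> N + cum k t"
          using \<open>N > 0\<close> pos k by auto
      qed
      finally have "cum k t + N \<le> (1 / 2) * (N + cum k t)"
        using st by (simp add: E_def N_def)
      then show False
        using \<open>N > 0\<close> pos k by force
    qed
  qed
qed

lemma cum_nonneg:
  assumes sums: "(\<Sum>i<m. a i) = (\<Sum>i<m. b i)" and init: "\<forall>k\<in>{1..<m}. cum k 1 \<ge> 0"
    and t: "t \<in> {0..1}"
  shows "\<forall>k\<in>{1..<m}. cum k t \<ge> 0"
proof -
  obtain h where h: "h > 0"
    "\<And>s t. s \<in> {0..1} \<Longrightarrow> t \<in> {0..1} \<Longrightarrow> s < t \<Longrightarrow> t - s \<le> h \<Longrightarrow>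
      \<forall>k\<in>{1..<m}. cum k t \<ge> 0 \<Longrightarrow> \<forall>k\<in>{1..<m}. cum k s \<ge> 0"
    using cum_nonneg_step [OF sums] by blast
  have "\<forall>k\<in>{1..<m}. cum k t \<ge> 0" if "1 - real n * h \<le> t" "t \<in> {0..1}" for n t
    using that
  proof (induction n arbitrary: t)
    case 0
    then show ?case using init by auto
  next
    case (Suc n)
    \<comment> \<open>One step to the right, without leaving the unit interval.\<close>
    define u where "u = min 1 (t + h)"
    show ?case
    proof (cases "t = 1")
      case False
      have "\<forall>k\<in>{1..<m}. cum k u \<ge> 0"
        using Suc h(1) by (intro Suc.IH) (auto simp: u_def algebra_simps)
      then show ?thesis
        using Suc.prems False h(1) by (intro h(2) [of t u]) (auto simp: u_def)
    qed (use init in simp)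
  qed
  moreover obtain n where "1 / h < real n"
    using reals_Archimedean2 by blast
  then have "1 - real n * h \<le> t"
    using h(1) t by (auto simp: field_simps)
  ultimately show ?thesis
    using t by blast
qed

lemma sum_lam_mono:
  assumes sums: "(\<Sum>i<m. a i) = (\<Sum>i<m. b i)" and init: "\<forall>k\<in>{1..<m}. cum k 1 \<ge> 0"
    and st: "0 \<le> s" "s \<le> t" "t \<le> 1" and k: "k \<le> m"
  shows "(\<Sum>i<k. lam i s) \<le> (\<Sum>i<k. lam i t)"
proof -
  let ?f = "\<lambda>u. \<Sum>i<k. lam i u"
  have deriv: "(?f has_real_derivative cum k u) (at u within {0..1})" if "u \<in> {0..1}" for u
    unfolding cum_def using that k by (intro DERIV_sum lam_has_derivative) auto
  have nonneg: "cum k u \<ge> 0" if "u \<in> {0..1}" for u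
    using cum_nonneg [OF sums init that] sum_vel [OF that] sums k
    by (cases "k = 0 \<or> k = m") (auto simp: cum_def)
  have "continuous_on {0..1} ?f"
    using deriv by (rule DERIV_continuous_on)
  then have cont: "continuous_on {s..t} ?f"
    by (rule continuous_on_subset) (use st in auto)
  show ?thesis
  proof (rule DERIV_nonneg_imp_increasing_open [OF \<open>s \<le> t\<close> _ cont])
    fix u assume "s < u" "u < t"
    then have "0 < u" "u < 1"
      using st by auto
    then show "\<exists>y. (?f has_real_derivative y) (at u) \<and> 0 \<le> y"
      using deriv [of u] nonneg [of u] at_within_Icc_at [of 0 u 1] by auto
  qed
qed

text \<open>The roots above \<open>c\<close> at time \<open>s\<close> are the first \<open>k\<close> ones for some \<open>k\<close>; the sum of the first \<open>k\<close> roots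
  grows with time, and at time \<open>t\<close> cutting off at 0 can only help.\<close>

lemma hinge_sum_mono:
  assumes sums: "(\<Sum>i<m. a i) = (\<Sum>i<m. b i)" and init: "\<forall>k\<in>{1..<m}. cum k 1 \<ge> 0"
    and st: "0 \<le> s" "s \<le> t" "t \<le> 1"
  shows "(\<Sum>i<m. max (lam i s - c) 0) \<le> (\<Sum>i<m. max (lam i t - c) 0)"
proof -
  define k where "k = (LEAST i. m \<le> i \<or> lam i s \<le> c)"
  have "m \<le> k \<or> lam k s \<le> c" and "k \<le> m"
    unfolding k_def by (rule LeastI [of _ m], simp, rule Least_le, simp)
  have above: "c < lam i s" if "i < k" for i
    using not_less_Least [of i "\<lambda>i. m \<le> i \<or> lam i s \<le> c"] that by (auto simp: k_def)
  have below: "lam i s \<le> c" if "k \<le> i" "i < m" for i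
    using \<open>m \<le> k \<or> lam k s \<le> c\<close> lam_gap [of k i s s] \<delta>_pos st that by (cases "i = k") auto
  have "(\<Sum>i<m. max (lam i s - c) 0) = (\<Sum>i<k. lam i s - c)"
    using \<open>k \<le> m\<close>
    by (intro sum.mono_neutral_cong_right) (auto simp: max_def dest: above below)
  also have "\<dots> \<le> (\<Sum>i<k. lam i t - c)"
    using sum_lam_mono [OF sums init st \<open>k \<le> m\<close>] by (simp add: sum_subtractf)
  also have "\<dots> \<le> (\<Sum>i<k. max (lam i t - c) 0)"
    by (intro sum_mono) simp
  also have "\<dots> \<le> (\<Sum>i<m. max (lam i t - c) 0)"
    using \<open>k \<le> m\<close> by (intro sum_mono2) auto
  finally show ?thesis .
qed

end

section \<open>Sums of the largest roots\<close>

text \<open>The sum of the \<open>k\<close> largest entries is the minimum over \<open>c\<close> of \<open>k c\<close> plus the sum of the positive parts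
  of \<open>x - c\<close>; the minimum is attained at the \<open>k\<close>-th entry (any upper bound serves for \<open>k = 0\<close>). The
  positive parts do not refer to an ordering and are additive under union of root multisets.\<close>

lemma top_sum_hinge:
  fixes xs :: "real list" and c :: real
  assumes "sorted_wrt (\<ge>) xs" "k \<le> length xs"
  shows "(\<Sum>i<k. xs ! i) \<le> k * c + (\<Sum>i<length xs. max (xs ! i - c) 0)"
    and "\<exists>c::real. (\<Sum>i<k. xs ! i) = k * c + (\<Sum>i<length xs. max (xs ! i - c) 0)"
proof -
  have "(\<Sum>i<k. xs ! i) - k * c = (\<Sum>i<k. xs ! i - c)"
    by (simp add: sum_subtractf)
  moreover have "(\<Sum>i<k. xs ! i - c) \<le> (\<Sum>i<k. max (xs ! i - c) 0)"
    by (intro sum_mono) simp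
  moreover have "(\<Sum>i<k. max (xs ! i - c) 0) \<le> (\<Sum>i<length xs. max (xs ! i - c) 0)"
    using assms(2) by (intro sum_mono2) auto
  ultimately show "(\<Sum>i<k. xs ! i) \<le> k * c + (\<Sum>i<length xs. max (xs ! i - c) 0)"
    by linarith
  have desc: "xs ! j \<le> xs ! i" if "i \<le> j" "j < length xs" for i j
    using assms(1) that by (cases "i = j") (auto simp: sorted_wrt_iff_nth_less)
  define c where "c = xs ! (k - 1)"
  have above: "c \<le> xs ! i" if "i < k" for i
    unfolding c_def using desc [of i "k - 1"] that assms(2) by auto
  have below: "xs ! i \<le> c" if "k \<le> i" "i < length xs" for i
    unfolding c_def using desc [of "k - 1" i] that by auto
  have "(\<Sum>i<length xs. max (xs ! i - c) 0) = (\<Sum>i<k. xs ! i - c)"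
    using assms(2) by (intro sum.mono_neutral_cong_right) (auto simp: max_def dest: above below)
  then have "(\<Sum>i<k. xs ! i) = k * c + (\<Sum>i<length xs. max (xs ! i - c) 0)"
    by (simp add: sum_subtractf)
  then show "\<exists>c::real. (\<Sum>i<k. xs ! i) = k * c + (\<Sum>i<length xs. max (xs ! i - c) 0)"
    by blast
qed

lemma
  fixes f :: "'i \<Rightarrow> real" and c :: real
  assumes "finite I" "k \<le> card I"
  defines "r \<equiv> monic_with_roots I f"
  shows sum_ordered_root_le_hinge:
      "(\<Sum>i=1..k. ordered_root r i) \<le> k * c + (\<Sum>i\<in>I. max (f i - c) 0)"
    and sum_ordered_root_eq_hinge:
      "\<exists>c::real. (\<Sum>i=1..k. ordered_root r i) = k * c + (\<Sum>i\<in>I. max (f i - c) 0)"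
    and sum_ordered_root_all: "(\<Sum>i=1..card I. ordered_root r i) = (\<Sum>i\<in>I. f i)"
proof -
  define xs where "xs = rev (sorted_list_of_multiset (proots r))"
  have mset: "mset xs = image_mset f (mset_set I)"
    using assms(1) by (simp add: xs_def r_def proots_monic_with_roots)
  have len: "length xs = card I"
    using mset by (metis size_image_mset size_mset size_mset_set)
  have sorted: "sorted_wrt (\<ge>) xs"
    by (simp add: xs_def sorted_wrt_rev)
  have top: "(\<Sum>i=1..k. ordered_root r i) = (\<Sum>i<k. xs ! i)" for k
    by (simp add: sum.atLeast1_atMost_eq ordered_root_def xs_def)
  have sum: "(\<Sum>i<length xs. g (xs ! i)) = (\<Sum>i\<in>I. g (f i))" for g :: "real \<Rightarrow> real"
  proof -
    have "(\<Sum>i<length xs. g (xs ! i)) = sum_list (map g xs)"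
      by (simp add: sum_list_sum_nth atLeast0LessThan)
    also have "\<dots> = (\<Sum>x\<in>#mset xs. g x)"
      by (metis mset_map sum_mset_sum_list)
    also have "\<dots> = (\<Sum>i\<in>I. g (f i))"
      by (simp add: mset image_mset.compositionality comp_def sum_unfold_sum_mset)
    finally show ?thesis .
  qed
  show "(\<Sum>i=1..k. ordered_root r i) \<le> k * c + (\<Sum>i\<in>I. max (f i - c) 0)"
    using top_sum_hinge(1) [OF sorted, of k c] assms(2)
    unfolding top len [symmetric] sum [of "\<lambda>x. max (x - c) 0", symmetric] by blast
  show "\<exists>c::real. (\<Sum>i=1..k. ordered_root r i) = k * c + (\<Sum>i\<in>I. max (f i - c) 0)"
    using top_sum_hinge(2) [OF sorted, of k] assms(2)
    unfolding top len [symmetric] sum [of "\<lambda>x. max (x - _) 0", symmetric] by blast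
  show "(\<Sum>i=1..card I. ordered_root r i) = (\<Sum>i\<in>I. f i)"
    using sum [of "\<lambda>x. x"] unfolding top len by simp
qed

lemma sum_le_sum_ordered_root:
  assumes "finite I" "J \<subseteq> I"
  shows "(\<Sum>i\<in>J. f i) \<le> (\<Sum>i=1..card J. ordered_root (monic_with_roots I f) i)"
proof -
  have "card J \<le> card I"
    using assms by (intro card_mono)
  then obtain c :: real where "(\<Sum>i=1..card J. ordered_root (monic_with_roots I f) i) =
      card J * c + (\<Sum>i\<in>I. max (f i - c) 0)"
    using sum_ordered_root_eq_hinge [OF assms(1)] by blast
  moreover have "(\<Sum>i\<in>J. f i - c) \<le> (\<Sum>i\<in>J. max (f i - c) 0)"
    by (intro sum_mono) simp
  moreover have "(\<Sum>i\<in>J. max (f i - c) 0) \<le> (\<Sum>i\<in>I. max (f i - c) 0)"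
    using assms by (intro sum_mono2) auto
  ultimately show ?thesis
    by (simp add: sum_subtractf)
qed

lemma poly_majorizes_hinge:
  assumes "finite I"
    and hinge: "\<And>c. (\<Sum>i\<in>I. max (g i - c) 0) \<le> (\<Sum>i\<in>I. max (f i - c) 0)"
    and total: "(\<Sum>i\<in>I. f i) = (\<Sum>i\<in>I. g i)"
  shows "poly_majorizes (monic_with_roots I f) (monic_with_roots I g)"
proof -
  have "(\<Sum>i=1..k. ordered_root (monic_with_roots I g) i) \<le> (\<Sum>i=1..k. ordered_root (monic_with_roots I f) i)"
    if k: "k \<le> card I" for k
  proof -
    obtain c :: real where c: "(\<Sum>i=1..k. ordered_root (monic_with_roots I f) i) = k * c + (\<Sum>i\<in>I. max (f i - c) 0)"
      using sum_ordered_root_eq_hinge [OF assms(1) k] by blast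
    then show ?thesis
      using sum_ordered_root_le_hinge [OF assms(1) k, of g c] hinge [of c] by linarith
  qed
  moreover have "(\<Sum>i=1..card I. ordered_root (monic_with_roots I f) i) =
      (\<Sum>i=1..card I. ordered_root (monic_with_roots I g) i)"
    using sum_ordered_root_all [OF assms(1) order_refl] total by simp
  ultimately show ?thesis
    using assms(1) by (simp add: poly_majorizes_def majorizes_def real_rooted_monic_with_roots)
qed

section \<open>Interlacing after removal of the common roots\<close>

definition nth_largest :: "real set \<Rightarrow> nat \<Rightarrow> real" where
  "nth_largest S i = rev (sorted_list_of_set S) ! i"

lemma
  assumes "finite S"
  shows nth_largest_image: "nth_largest S ` {..<card S} = S"
    and nth_largest_less: "i < j \<Longrightarrow> j < card S \<Longrightarrow> nth_largest S j < nth_largest S i"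
proof -
  let ?xs = "rev (sorted_list_of_set S)"
  have xs: "set ?xs = S" "length ?xs = card S" "sorted_wrt (>) ?xs"
    using assms by (simp_all add: sorted_wrt_rev)
  show "nth_largest S ` {..<card S} = S"
    using nth_image [of "card S" ?xs] xs(1,2) by (simp add: nth_largest_def [abs_def] atLeast0LessThan)
  show "nth_largest S j < nth_largest S i" if "i < j" "j < card S"
    using xs(2,3) that unfolding nth_largest_def sorted_wrt_iff_nth_less by simp
qed

lemma nth_largest_in: "finite S \<Longrightarrow> i < card S \<Longrightarrow> nth_largest S i \<in> S"
  using nth_largest_image by blast

lemma nth_largest_less_iff:
  assumes "finite S" "i < card S" "j < card S"
  shows "nth_largest S j < nth_largest S i \<longleftrightarrow> i < j"
  using nth_largest_less [OF assms(1), of i j] nth_largest_less [OF assms(1), of j i] assms(2,3)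
  by (cases i j rule: linorder_cases) auto

lemma nth_largest_inj:
  assumes "finite S" "k \<le> card S"
  shows "inj_on (nth_largest S) {..<k}"
proof (rule inj_on_subset)
  show "inj_on (nth_largest S) {..<card S}"
    using assms(1) by (intro eq_card_imp_inj_on) (simp_all add: nth_largest_image)
  show "{..<k} \<subseteq> {..<card S}"
    using assms(2) by auto
qed

lemma card_nth_largest_image:
  assumes "finite S" "k \<le> card S"
  shows "card (nth_largest S ` {..<k}) = k"
  using nth_largest_inj [OF assms] by (simp add: card_image)

lemma elements_above_nth_largest:
  assumes "finite S" "i < card S"
  shows "{x \<in> S. nth_largest S i < x} = nth_largest S ` {..<i}"
proof -
  have S: "x \<in> S \<longleftrightarrow> x \<in> nth_largest S ` {..<card S}" for x
    using nth_largest_image [OF assms(1)] by simp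
  have "{x \<in> S. nth_largest S i < x} = nth_largest S ` {j. j < card S \<and> nth_largest S i < nth_largest S j}"
    using S by auto
  also have "{j. j < card S \<and> nth_largest S i < nth_largest S j} = {..<i}"
    using nth_largest_less_iff [OF assms(1) _ assms(2)] assms(2) by auto
  finally show ?thesis .
qed

lemma elements_above:
  assumes "finite S"
  shows "{x \<in> S. v < x} = nth_largest S ` {..<card {x \<in> S. v < x}}"
proof (cases "{x \<in> S. x \<le> v} = {}")
  case True
  then have "{x \<in> S. v < x} = S"
    by auto
  then show ?thesis
    using nth_largest_image [OF assms] by simp
next
  case False
  define x where "x = Max {x \<in> S. x \<le> v}"
  have "x \<in> {x \<in> S. x \<le> v}"
    unfolding x_def using False assms by (intro Max_in) auto
  moreover have "y \<le> x" if "y \<in> S" "y \<le> v" for y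
    unfolding x_def using that assms by (intro Max_ge) auto
  ultimately have *: "{y \<in> S. v < y} = {y \<in> S. x < y}" "x \<in> S"
    by force+
  then obtain i where i: "i < card S" "x = nth_largest S i"
    using nth_largest_image [OF assms] by blast
  have "{y \<in> S. v < y} = nth_largest S ` {..<i}"
    using * i elements_above_nth_largest [OF assms i(1)] by simp
  moreover have "card (nth_largest S ` {..<i}) = i"
    using i assms by (intro card_nth_largest_image) auto
  ultimately show ?thesis
    by simp
qed

lemma card_above_nth_largest:
  assumes "finite S" "i < card S"
  shows "card {x \<in> S. nth_largest S i < x} = i"
  using assms by (simp add: elements_above_nth_largest card_nth_largest_image)

lemma ordered_root_simple:
  assumes "finite A" "p = monic_with_roots A (\<lambda>x. x)"
  shows "ordered_root p i = nth_largest A (i - 1)"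
  using assms by (simp add: ordered_root_def nth_largest_def proots_monic_with_roots)

text \<open>Counting roots above a level expresses interlacing in a form that does not change when common
  elements of \<open>A\<close> and \<open>B\<close> are removed.\<close>

lemma card_above_interlaced:
  fixes A B :: "real set"
  assumes "finite A" "finite B" "card A = card B"
    and inter: "\<And>i. Suc i < card A \<Longrightarrow> nth_largest A (Suc i) \<le> nth_largest B i"
  shows "card {x \<in> A. v < x} \<le> Suc (card {x \<in> B. v < x})"
proof -
  define k where "k = card {x \<in> A. v < x}"
  have "k \<le> card A"
    unfolding k_def using assms(1) by (intro card_mono) auto
  have "nth_largest B ` {..<k - 1} \<subseteq> {x \<in> B. v < x}"
  proof clarify
    fix i assume i: "i < k - 1"
    then have "nth_largest A (Suc i) \<in> {x \<in> A. v < x}"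
      using elements_above [OF assms(1), of v] unfolding k_def by auto
    moreover have "nth_largest A (Suc i) \<le> nth_largest B i" "nth_largest B i \<in> B"
      using i \<open>k \<le> card A\<close> assms(2,3) by (auto intro!: inter nth_largest_in)
    ultimately show "nth_largest B i \<in> B \<and> v < nth_largest B i"
      by simp
  qed
  then have "card (nth_largest B ` {..<k - 1}) \<le> card {x \<in> B. v < x}"
    using assms(2) by (intro card_mono) auto
  moreover have "card (nth_largest B ` {..<k - 1}) = k - 1"
    using \<open>k \<le> card A\<close> assms(2,3) by (intro card_nth_largest_image) auto
  ultimately show ?thesis
    by (simp add: k_def)
qed

text \<open>Otherwise, above the level \<open>v = nth_largest (B - A) i\<close> the set \<open>A - B\<close> has at least \<open>j + 1\<close> elements and
  \<open>B - A\<close> only \<open>i\<close>, so that \<open>A\<close> would have at least two more elements above \<open>v\<close> than \<open>B\<close>.\<close>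

lemma nth_largest_Diff_less:
  assumes "finite A" "finite B" "card A = card B"
    and inter: "\<And>i. Suc i < card A \<Longrightarrow> nth_largest A (Suc i) \<le> nth_largest B i"
    and ij: "i < j" "j < card (A - B)"
  shows "nth_largest (A - B) j < nth_largest (B - A) i"
proof (rule ccontr)
  have card: "card (A - B) = card (B - A)"
    using assms(1-3) by (metis card_Diff_subset_Int finite_Int inf_commute)
  define v where "v = nth_largest (B - A) i"
  assume "\<not> ?thesis"
  moreover have a: "nth_largest (A - B) j \<in> A - B" and "v \<in> B - A"
    unfolding v_def using assms card by (auto intro!: nth_largest_in simp del: Diff_iff)
  moreover have "nth_largest (A - B) j \<noteq> v"
    using a \<open>v \<in> B - A\<close> by auto
  ultimately have v: "v < nth_largest (A - B) j"
    unfolding v_def by linarith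
  have "insert (nth_largest (A - B) j) {x \<in> A - B. nth_largest (A - B) j < x} \<subseteq> {x \<in> A - B. v < x}"
    using a v by auto
  then have "card (insert (nth_largest (A - B) j) {x \<in> A - B. nth_largest (A - B) j < x}) \<le> card {x \<in> A - B. v < x}"
    using assms(1) by (intro card_mono) auto
  then have "Suc j \<le> card {x \<in> A - B. v < x}"
    using card_above_nth_largest [of "A - B" j] assms(1) ij by simp
  moreover have "card {x \<in> B - A. v < x} = i"
    unfolding v_def using assms(2) ij card by (intro card_above_nth_largest) auto
  moreover have "card {x \<in> A. v < x} = card {x \<in> A - B. v < x} + card {x \<in> A \<inter> B. v < x}"
    using assms(1) by (subst card_Un_disjoint [symmetric]) (auto intro: arg_cong [of _ _ card])
  moreover have "card {x \<in> B. v < x} = card {x \<in> B - A. v < x} + card {x \<in> A \<inter> B. v < x}"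
    using assms(2) by (subst card_Un_disjoint [symmetric]) (auto intro: arg_cong [of _ _ card])
  ultimately show False
    using card_above_interlaced [OF assms(1-4), of v] ij by simp
qed

lemma separated_roots_Diff:
  assumes "finite A" "finite B" "card A = card B"
    and "\<And>i. Suc i < card A \<Longrightarrow> nth_largest A (Suc i) \<le> nth_largest B i"
    and "\<And>i. Suc i < card A \<Longrightarrow> nth_largest B (Suc i) \<le> nth_largest A i"
  shows "separated_roots (card (A - B)) (nth_largest (A - B)) (nth_largest (B - A))"
proof
  have card: "card (A - B) = card (B - A)"
    using assms(1-3) by (metis card_Diff_subset_Int finite_Int inf_commute)
  fix i j
  show "nth_largest (A - B) i \<noteq> nth_largest (B - A) i" if "i < card (A - B)"
    using nth_largest_in [of "A - B" i] nth_largest_in [of "B - A" i] that card assms(1,2) by force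
  show "max (nth_largest (A - B) j) (nth_largest (B - A) j) < min (nth_largest (A - B) i) (nth_largest (B - A) i)"
    if "i < j" "j < card (A - B)"
    using that card assms nth_largest_Diff_less [of A B i j] nth_largest_Diff_less [of B A i j]
      nth_largest_less [of "A - B" i j] nth_largest_less [of "B - A" i j] by simp
qed

lemma monic_with_roots_split:
  assumes "finite A"
  shows "monic_with_roots A (\<lambda>x. x) =
    monic_with_roots (A \<inter> B) (\<lambda>x. x) * monic_with_roots {..<card (A - B)} (nth_largest (A - B))"
proof -
  have "monic_with_roots (A - B) (\<lambda>x. x) = monic_with_roots {..<card (A - B)} (nth_largest (A - B))"
    using prod.reindex [OF nth_largest_inj [OF _ order_refl, of "A - B"], of "\<lambda>x. [:- x, 1:]"] assms
    by (simp add: monic_with_roots_def nth_largest_image)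
  moreover have "monic_with_roots A (\<lambda>x. x) = monic_with_roots (A \<inter> B) (\<lambda>x. x) * monic_with_roots (A - B) (\<lambda>x. x)"
    unfolding monic_with_roots_def using assms by (rule prod.Int_Diff)
  ultimately show ?thesis
    by simp
qed

lemma monic_with_roots_Plus:
  assumes "finite I" "finite J"
  shows "monic_with_roots (I <+> J) (case_sum f g) = monic_with_roots I f * monic_with_roots J g"
  using assms by (simp add: monic_with_roots_def prod.Plus comp_def)

section \<open>The criterion\<close>

lemma derivative_at_right_end_nonneg:
  fixes f :: "real \<Rightarrow> real"
  assumes "(f has_real_derivative D) (at 1 within {0..1})" "\<And>t. t \<in> {0..1} \<Longrightarrow> f t \<le> f 1"
  shows "D \<ge> 0"
proof (rule tendsto_lowerbound)
  show "((\<lambda>t. (f t - f 1) / (t - 1)) \<longlongrightarrow> D) (at 1 within {0..1})"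
    using assms(1) by (simp add: has_field_derivative_iff)
  have "\<forall>\<^sub>F t in at 1 within {0..1::real}. t \<in> {0..1} \<and> t \<noteq> 1"
    by (auto simp: eventually_at_filter)
  then show "\<forall>\<^sub>F t in at 1 within {0..1}. 0 \<le> (f t - f 1) / (t - 1)"
    by eventually_elim (use assms(2) in \<open>auto intro!: divide_nonpos_nonpos\<close>)
  show "at 1 within {0..1::real} \<noteq> bot"
    by (simp add: at_within_Icc_at_left)
qed

theorem theorem3p3:
  fixes p q :: "real poly" and n :: nat
  assumes "degree p = n" and "degree q = n"
    and "lead_coeff p = 1" and "lead_coeff q = 1"
    and "real_rooted p" and "real_rooted q"
    and "rsquarefree p" and "rsquarefree q"
    and "common_interlacer p q"
  shows "strongly_majorizes p q \<longleftrightarrow>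
    (\<forall>k. 1 \<le> k \<and> k < n \<longrightarrow>
       (\<Sum>i=1..k. poly q (ordered_root p i) / poly (pderiv p) (ordered_root p i)) \<ge> 0) \<and>
    (\<Sum>i=1..n. ordered_root p i) = (\<Sum>i=1..n. ordered_root q i)"
proof -
  define A B where "A = {x. poly p x = 0}" and "B = {x. poly q x = 0}"
  have p: "p = monic_with_roots A (\<lambda>x. x)" and q: "q = monic_with_roots B (\<lambda>x. x)"
    unfolding A_def B_def using assms by (auto intro: simple_rooted_factorization)
  have "p \<noteq> 0" "q \<noteq> 0"
    using assms(3,4) by auto
  then have fin: "finite A" "finite B"
    unfolding A_def B_def by (auto intro: poly_roots_finite)
  have card: "card A = n" "card B = n"
    using assms(1,2) p q degree_monic_with_roots by metis+
  note root_p = ordered_root_simple [OF fin(1) p] and root_q = ordered_root_simple [OF fin(2) q]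

  define H where "H = A \<inter> B"
  define m where "m = card (A - B)"
  define a b where "a = nth_largest (A - B)" and "b = nth_largest (B - A)"
  have m': "card (B - A) = m"
    using fin card by (metis card_Diff_subset_Int finite_Int inf_commute m_def)
  have interlaced: "nth_largest A (Suc i) \<le> nth_largest B i" "nth_largest B (Suc i) \<le> nth_largest A i"
    if "Suc i < card A" for i
    using assms(9) that card assms(1) unfolding common_interlacer_def root_p root_q
    by (auto dest!: spec [of _ "Suc i"])
  interpret separated_roots m a b
    unfolding m_def a_def b_def using fin card interlaced by (intro separated_roots_Diff) auto
  have a_less: "a j < a i \<longleftrightarrow> i < j" if "i < m" "j < m" for i j
    using nth_largest_less_iff [of "A - B"] fin that unfolding a_def m_def by auto
  have a_inj: "inj_on a {..<m}"
    using nth_largest_inj [of "A - B" m] fin unfolding a_def m_def by auto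
  have a_image: "a ` {..<m} = A - B"
    using nth_largest_image [of "A - B"] fin unfolding a_def m_def by auto
  have finH: "finite H"
    using fin by (simp add: H_def)

  define h where "h = monic_with_roots H (\<lambda>x. x)"
  have p_split: "p = h * P"
    unfolding P_def unfolding p h_def H_def a_def m_def by (rule monic_with_roots_split [OF fin(1)])
  have q_split: "q = h * Q"
    using monic_with_roots_split [OF fin(2), of A]
    unfolding Q_def unfolding q h_def H_def b_def m' [symmetric] by (simp add: Int_commute)

  \<comment> \<open>Roots of the pencil are indexed by a common root, which stays fixed, or by a root curve.\<close>
  define I where "I = H <+> {..<m}"
  define L where "L t = case_sum (\<lambda>x. x) (\<lambda>i. lam i t)" for t
  have finI: "finite I"
    using finH by (simp add: I_def)
  have pencil: "smult t p + smult (1 - t) q = monic_with_roots I (L t)" if "t \<in> {0..1}" for t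
  proof -
    have "smult t p + smult (1 - t) q = h * R t"
      by (simp add: p_split q_split R_def algebra_simps)
    then show ?thesis
      using R_eq [OF that] finH by (simp add: I_def L_def h_def monic_with_roots_Plus)
  qed
  have sum_I: "(\<Sum>i\<in>I. F (L t i)) = (\<Sum>x\<in>H. F x) + (\<Sum>i<m. F (lam i t))" for F :: "real \<Rightarrow> real" and t
    using finH by (simp add: I_def L_def sum.Plus comp_def)
  have sum_a: "(\<Sum>x\<in>A - B. F x) = (\<Sum>i<m. F (a i))" for F :: "real \<Rightarrow> real"
    using sum.reindex [OF a_inj, of F] by (simp add: a_image)

  have sums_iff: "(\<Sum>i=1..n. ordered_root p i) = (\<Sum>i=1..n. ordered_root q i) \<longleftrightarrow>
      (\<Sum>i<m. a i) = (\<Sum>i<m. b i)"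
  proof -
    have "(\<Sum>i=1..n. ordered_root p i) = (\<Sum>x\<in>A. x)" "(\<Sum>i=1..n. ordered_root q i) = (\<Sum>x\<in>B. x)"
      using sum_ordered_root_all [OF fin(1) order_refl, of "\<lambda>x. x"]
        sum_ordered_root_all [OF fin(2) order_refl, of "\<lambda>x. x"] p q card by auto
    moreover have "(\<Sum>x\<in>A. x) = (\<Sum>x\<in>H. x) + (\<Sum>i<m. a i)"
      using sum.Int_Diff [OF fin(1), of "\<lambda>x. x" B] sum_a [of "\<lambda>x. x"] by (simp add: H_def)
    moreover have "(\<Sum>x\<in>B. x) = (\<Sum>x\<in>H. x) + (\<Sum>i<m. b i)"
    proof -
      have "(\<Sum>x\<in>B - A. x) = (\<Sum>i<m. b i)"
        using sum.reindex [OF nth_largest_inj [OF _ order_refl, of "B - A"], of "\<lambda>x. x"] nth_largest_image [of "B - A"] fin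
        by (simp add: b_def m')
      then show ?thesis
        using sum.Int_Diff [OF fin(2), of "\<lambda>x. x" A] by (simp add: H_def Int_commute)
    qed
    ultimately show ?thesis
      by simp
  qed

  define V where "V x = poly q x / poly (pderiv p) x" for x
  have V_H: "V x = 0" if "x \<in> H" for x
    using that by (simp add: V_def H_def B_def)
  have V_a: "V (a i) = vel i 1" if i: "i < m" for i
  proof -
    have "a i \<notin> H"
      using a_image i by (auto simp: H_def)
    then have "poly h (a i) \<noteq> 0"
      using finH by (auto simp: h_def poly_monic_with_roots)
    have P0: "poly P (a i) = 0"
      using i by (auto simp: P_def poly_monic_with_roots)
    have "poly (pderiv P) (a i) = (\<Prod>j\<in>{..<m} - {i}. a i - a j)"
      unfolding P_def using i by (intro poly_pderiv_monic_with_roots) auto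
    also have "\<dots> = (\<Prod>j\<in>{..<m} - {i}. lam i 1 - lam j 1)"
      using i by (intro prod.cong) (auto simp: lam_1)
    finally have "vel i 1 = poly Q (a i) / poly (pderiv P) (a i)"
      using i P0 by (simp add: vel_def lam_1 [OF i])
    moreover have "V (a i) = (poly h (a i) * poly Q (a i)) / (poly h (a i) * poly (pderiv P) (a i))"
      using P0 by (simp add: V_def p_split q_split pderiv_mult)
    ultimately show ?thesis
      using \<open>poly h (a i) \<noteq> 0\<close> by simp
  qed

  \<comment> \<open>The \<open>k\<close> largest roots of \<open>p\<close>, and the indices of those among them that move.\<close>
  define T where "T k = nth_largest A ` {..<k}" for k
  define J where "J k = {i. i < m \<and> a i \<in> T k}" for k
  have T_sub: "T k \<subseteq> A" if "k \<le> n" for k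
    using nth_largest_in [OF fin(1)] that card by (auto simp: T_def)
  have a_J: "a ` J k = T k - H" if "k \<le> n" for k
    using a_image T_sub [OF that] by (auto simp: J_def H_def)
  have sum_T: "(\<Sum>i=1..k. F (ordered_root p i)) = (\<Sum>x\<in>H \<inter> T k. F x) + (\<Sum>i\<in>J k. F (a i))"
    if k: "k \<le> n" for k and F :: "real \<Rightarrow> real"
  proof -
    have "inj_on (nth_largest A) {..<k}"
      using fin(1) k card by (intro nth_largest_inj) auto
    then have "(\<Sum>x\<in>T k. F x) = (\<Sum>i<k. F (nth_largest A i))"
      unfolding T_def by (simp add: sum.reindex)
    then have "(\<Sum>i=1..k. F (ordered_root p i)) = (\<Sum>x\<in>T k. F x)"
      by (simp add: root_p sum.atLeast1_atMost_eq)
    also have "\<dots> = (\<Sum>x\<in>T k \<inter> H. F x) + (\<Sum>x\<in>T k - H. F x)"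
      by (rule sum.Int_Diff) (simp add: T_def)
    also have "(\<Sum>x\<in>T k - H. F x) = (\<Sum>i\<in>J k. F (a i))"
    proof -
      have "inj_on a (J k)"
        by (rule inj_on_subset [OF a_inj]) (auto simp: J_def)
      then show ?thesis
        unfolding a_J [OF k, symmetric] by (simp add: sum.reindex)
    qed
    finally show ?thesis
      by (simp add: Int_commute)
  qed
  have sum_V: "(\<Sum>i=1..k. V (ordered_root p i)) = (\<Sum>i\<in>J k. vel i 1)" if "k \<le> n" for k
    using sum_T [OF that, of V] V_H V_a by (simp add: J_def)

  show ?thesis
    unfolding sums_iff V_def [symmetric]
  proof (intro iffI conjI allI impI)
    assume strong: "strongly_majorizes p q"
    have maj: "poly_majorizes p (smult t p + smult (1 - t) q)" if "t \<in> {0..1}" for t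
    proof -
      have "poly_majorizes (smult 1 p + smult (1 - 1) q) (smult t p + smult (1 - t) q)"
        using that strong unfolding strongly_majorizes_def by (metis atLeastAtMost_iff order_refl)
      then show ?thesis
        by simp
    qed
    show "(\<Sum>i<m. a i) = (\<Sum>i<m. b i)"
      using maj [of 0] unfolding sums_iff [symmetric] poly_majorizes_def majorizes_def assms(1)
      by (simp add: assms(2))
    fix k assume k: "1 \<le> k \<and> k < n"
    then have "k \<le> n"
      by simp
    have "(\<Sum>i\<in>J k. vel i 1) \<ge> 0"
    proof (rule derivative_at_right_end_nonneg)
      show "((\<lambda>t. \<Sum>i\<in>J k. lam i t) has_real_derivative (\<Sum>i\<in>J k. vel i 1)) (at 1 within {0..1})"
        by (intro DERIV_sum lam_has_derivative) (auto simp: J_def)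
      fix t :: real assume t: "t \<in> {0..1}"
      \<comment> \<open>The \<open>k\<close> curves that start at the largest roots of \<open>p\<close> need not stay the largest, since they may
        cross common roots; but their sum is a lower bound, attained at \<open>t = 1\<close>.\<close>
      define K where "K = (H \<inter> T k) <+> J k"
      have "K \<subseteq> I"
        by (auto simp: K_def I_def J_def)
      have fin': "finite (H \<inter> T k)" "finite (J k)"
        using finH by (simp_all add: J_def)
      have "card K = k"
        using sum_T [OF \<open>k \<le> n\<close>, of "\<lambda>_. 1"] fin' by (simp add: K_def card_Plus flip: of_nat_add)
      have "(\<Sum>i\<in>K. L t i) \<le> (\<Sum>i=1..k. ordered_root (monic_with_roots I (L t)) i)"
        using sum_le_sum_ordered_root [OF finI \<open>K \<subseteq> I\<close>, of "L t"] \<open>card K = k\<close> by simp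
      also have "\<dots> \<le> (\<Sum>i=1..k. ordered_root p i)"
        using maj [OF t] \<open>k \<le> n\<close> assms(1) pencil [OF t] by (simp add: poly_majorizes_def majorizes_def)
      also have "\<dots> = (\<Sum>x\<in>H \<inter> T k. x) + (\<Sum>i\<in>J k. a i)"
        using sum_T [OF \<open>k \<le> n\<close>, of "\<lambda>x. x"] .
      also have "(\<Sum>i\<in>J k. a i) = (\<Sum>i\<in>J k. lam i 1)"
        by (intro sum.cong) (auto simp: J_def lam_1)
      finally show "(\<Sum>i\<in>J k. lam i t) \<le> (\<Sum>i\<in>J k. lam i 1)"
        using fin' by (simp add: K_def L_def sum.Plus comp_def)
    qed
    then show "(\<Sum>i=1..k. V (ordered_root p i)) \<ge> 0"
      using sum_V [OF \<open>k \<le> n\<close>] by simp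
  next
    assume *: "(\<forall>k. 1 \<le> k \<and> k < n \<longrightarrow> (\<Sum>i=1..k. V (ordered_root p i)) \<ge> 0) \<and> (\<Sum>i<m. a i) = (\<Sum>i<m. b i)"
    then have sums: "(\<Sum>i<m. a i) = (\<Sum>i<m. b i)"
      by blast
    have init: "\<forall>k\<in>{1..<m}. cum k 1 \<ge> 0"
    proof
      fix k assume k: "k \<in> {1..<m}"
      \<comment> \<open>The first \<open>k\<close> moving roots are those among the \<open>K\<close> largest roots of \<open>p\<close>.\<close>
      define K where "K = card {x \<in> A. a k < x}"
      have T: "T K = {x \<in> A. a k < x}"
        using elements_above [OF fin(1)] by (simp add: T_def K_def)
      have in_A: "a i \<in> A" if "i < m" for i
        using a_image that by blast
      have "a 0 \<in> {x \<in> A. a k < x}"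
        using in_A [of 0] a_less [of 0 k] k by auto
      then have "card {x \<in> A. a k < x} > 0"
        using fin(1) by (subst card_gt_0_iff) auto
      then have "1 \<le> K"
        by (simp add: K_def)
      have "K < n"
        unfolding K_def card(1) [symmetric] using fin in_A [of k] k by (intro psubset_card_mono) auto
      moreover have "J K = {..<k}"
        unfolding J_def T using in_A a_less k by auto
      moreover have "(\<Sum>i=1..K. V (ordered_root p i)) \<ge> 0"
        using * \<open>1 \<le> K\<close> \<open>K < n\<close> by blast
      ultimately show "cum k 1 \<ge> 0"
        using sum_V [of K] by (simp add: cum_def)
    qed
    show "strongly_majorizes p q"
      unfolding strongly_majorizes_def
    proof (intro conjI allI impI)
      fix s t :: real
      assume st: "0 \<le> t \<and> t \<le> s \<and> s \<le> 1"
      then have st': "s \<in> {0..1}" "t \<in> {0..1}"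
        by auto
      have "poly_majorizes (monic_with_roots I (L s)) (monic_with_roots I (L t))"
      proof (rule poly_majorizes_hinge [OF finI])
        show "(\<Sum>i\<in>I. max (L t i - c) 0) \<le> (\<Sum>i\<in>I. max (L s i - c) 0)" for c
          using hinge_sum_mono [OF sums init, of t s c] st by (simp add: sum_I [of "\<lambda>x. max (x - c) 0"])
        show "(\<Sum>i\<in>I. L s i) = (\<Sum>i\<in>I. L t i)"
          using sum_I [of "\<lambda>x. x"] sum_lam st' sums by (simp add: algebra_simps)
      qed
      then show "poly_majorizes (smult s p + smult (1 - s) q) (smult t p + smult (1 - t) q)"
        using pencil st' by simp
    qed (rule assms(9))
  qed
qed

end
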